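(* The derivability problem for $\mathbf{P}[\bot_w]$ is decidable in linear time: there is an algorithm which, given a finite set $\Gamma$ of infons and an infon $\varphi$, decides whether $\Gamma\vdash\varphi$ in $\mathbf{P}[\bot_w]$ in time linear in the total length of $\Gamma$ and $\varphi$.
   Context: Infons: fix a set $At$ of atomic infons; infons are generated by $\varphi ::= \top\mid\bot \mid At \mid (\varphi\wedge\varphi)\mid(\varphi\to\varphi)$. In $\mathbf{P}[\bot_w]$, $\Gamma\vdash\varphi$ iff there is a finite sequence ending in $\varphi$ whose members are in $\Gamma\cup\{\top\}$ or follow from earlier members by the rules: from $\varphi_1,\varphi_2$ infer $\varphi_1\wedge\varphi_2$; from $\varphi_1\wedge\varphi_2$ infer $\varphi_i$ ($i=1,2$); from $\varphi_2$ infer $\varphi_1\to\varphi_2$ (any $\varphi_1$); from $\varphi_1$ and $\varphi_1\to\varphi_2$ infer $\varphi_2$; from $\bot$ and $\varphi\to\psi$ infer $\psi$. *)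

theory Defs
  imports Main
begin

section \<open>Infons and derivability\<close>

datatype 'a infon =
    Top
  | Bot
  | Atom 'a
  | Conj "'a infon" "'a infon"
  | Imp "'a infon" "'a infon"

inductive infers :: "'a infon set \<Rightarrow> 'a infon \<Rightarrow> bool" for S where
  conj_intro: "\<phi>1 \<in> S \<Longrightarrow> \<phi>2 \<in> S \<Longrightarrow> infers S (Conj \<phi>1 \<phi>2)"
| conj_elim1: "Conj \<phi>1 \<phi>2 \<in> S \<Longrightarrow> infers S \<phi>1"
| conj_elim2: "Conj \<phi>1 \<phi>2 \<in> S \<Longrightarrow> infers S \<phi>2"
| imp_intro: "\<phi>2 \<in> S \<Longrightarrow> infers S (Imp \<phi>1 \<phi>2)"
| imp_elim: "\<phi>1 \<in> S \<Longrightarrow> Imp \<phi>1 \<phi>2 \<in> S \<Longrightarrow> infers S \<phi>2"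
| weak_bot: "Bot \<in> S \<Longrightarrow> Imp \<phi> \<psi> \<in> S \<Longrightarrow> infers S \<psi>"

definition is_derivation :: "'a infon set \<Rightarrow> 'a infon list \<Rightarrow> bool" where
  "is_derivation \<Gamma> ds \<longleftrightarrow>
     (\<forall>i < length ds. ds ! i \<in> \<Gamma> \<union> {Top} \<or> infers (set (take i ds)) (ds ! i))"

definition derives :: "'a infon set \<Rightarrow> 'a infon \<Rightarrow> bool"  (infix "\<turnstile>" 50) where
  "\<Gamma> \<turnstile> \<phi> \<longleftrightarrow> (\<exists>ds. ds \<noteq> [] \<and> last ds = \<phi> \<and> is_derivation \<Gamma> ds)"

section \<open>Written form of infons\<close>

text \<open>
  Infons are written in fully parenthesised infix form over a fixed finite alphabet.
  An atomic infon is written as its name, a bit string, so it contributes the length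
  of its name (and not just 1) to the length of an infon.
\<close>

datatype symbol =
  STop | SBot | SAnd | SImp | LParen | RParen | Bit0 | Bit1 | Comma | Turnstile

fun bit_symbol :: "bool \<Rightarrow> symbol" where
  "bit_symbol False = Bit0"
| "bit_symbol True = Bit1"

fun write_infon :: "('a \<Rightarrow> bool list) \<Rightarrow> 'a infon \<Rightarrow> symbol list" where
  "write_infon name Top = [STop]"
| "write_infon name Bot = [SBot]"
| "write_infon name (Atom a) = map bit_symbol (name a)"
| "write_infon name (Conj \<phi> \<psi>) =
     [LParen] @ write_infon name \<phi> @ [SAnd] @ write_infon name \<psi> @ [RParen]"
| "write_infon name (Imp \<phi> \<psi>) =
     [LParen] @ write_infon name \<phi> @ [SImp] @ write_infon name \<psi> @ [RParen]"

definition infon_length :: "('a \<Rightarrow> bool list) \<Rightarrow> 'a infon \<Rightarrow> nat" where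
  "infon_length name \<phi> = length (write_infon name \<phi>)"

text \<open>
  A problem instance is a pair of a list of infons, which presents the finite set of
  hypotheses, and an infon, the query. It is written as
  \<open>\<gamma>1, \<dots>, \<gamma>m, \<turnstile> \<phi>\<close>, every hypothesis being followed by a comma.
\<close>

definition write_instance ::
  "('a \<Rightarrow> bool list) \<Rightarrow> 'a infon list \<times> 'a infon \<Rightarrow> symbol list" where
  "write_instance name = (\<lambda>(\<gamma>s, \<phi>).
     concat (map (\<lambda>\<gamma>. write_infon name \<gamma> @ [Comma]) \<gamma>s) @ [Turnstile] @ write_infon name \<phi>)"

definition total_length ::
  "('a \<Rightarrow> bool list) \<Rightarrow> 'a infon list \<times> 'a infon \<Rightarrow> nat" where
  "total_length name = (\<lambda>(\<gamma>s, \<phi>). (\<Sum>\<gamma>\<leftarrow>\<gamma>s. infon_length name \<gamma>) + infon_length name \<phi>)"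

section \<open>Random access machines\<close>

text \<open>
  The machine has registers, named explicitly by the program, and a memory that is
  accessed only through an address held in a register. Every instruction costs one
  unit of time. The unit-cost measure is made realistic by requiring below that in a
  run on an input of size \<open>n\<close> all words have \<open>O(log n)\<close> bits.
\<close>

type_synonym reg = nat

datatype instr =
    Const reg nat
  | Move reg reg
  | Add reg reg reg
  | Sub reg reg reg
  | Mul reg reg reg
  | Load reg reg
  | Store reg reg
  | Jump nat
  | JumpLess reg reg nat
  | JumpEq reg reg nat

record config =
  pc :: nat
  regs :: "reg \<Rightarrow> nat"
  mem :: "nat \<Rightarrow> nat"

fun exec :: "instr \<Rightarrow> config \<Rightarrow> config" where
  "exec (Const r k) c = c\<lparr>pc := pc c + 1, regs := (regs c)(r := k)\<rparr>"
| "exec (Move r s) c = c\<lparr>pc := pc c + 1, regs := (regs c)(r := regs c s)\<rparr>"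
| "exec (Add r s t) c = c\<lparr>pc := pc c + 1, regs := (regs c)(r := regs c s + regs c t)\<rparr>"
| "exec (Sub r s t) c = c\<lparr>pc := pc c + 1, regs := (regs c)(r := regs c s - regs c t)\<rparr>"
| "exec (Mul r s t) c = c\<lparr>pc := pc c + 1, regs := (regs c)(r := regs c s * regs c t)\<rparr>"
| "exec (Load r s) c = c\<lparr>pc := pc c + 1, regs := (regs c)(r := mem c (regs c s))\<rparr>"
| "exec (Store r s) c = c\<lparr>pc := pc c + 1, mem := (mem c)(regs c r := regs c s)\<rparr>"
| "exec (Jump l) c = c\<lparr>pc := l\<rparr>"
| "exec (JumpLess r s l) c = c\<lparr>pc := (if regs c r < regs c s then l else pc c + 1)\<rparr>"
| "exec (JumpEq r s l) c = c\<lparr>pc := (if regs c r = regs c s then l else pc c + 1)\<rparr>"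

type_synonym program = "instr list"

definition halted :: "program \<Rightarrow> config \<Rightarrow> bool" where
  "halted P c \<longleftrightarrow> pc c \<ge> length P"

definition step :: "program \<Rightarrow> config \<Rightarrow> config" where
  "step P c = (if halted P c then c else exec (P ! pc c) c)"

definition run :: "program \<Rightarrow> nat \<Rightarrow> config \<Rightarrow> config" where
  "run P t c = (step P ^^ t) c"

text \<open>Symbols are coded by positive numbers, so they differ from the blank memory cells.\<close>

fun symbol_code :: "symbol \<Rightarrow> nat" where
  "symbol_code STop = 1"
| "symbol_code SBot = 2"
| "symbol_code SAnd = 3"
| "symbol_code SImp = 4"
| "symbol_code LParen = 5"
| "symbol_code RParen = 6"
| "symbol_code Bit0 = 7"
| "symbol_code Bit1 = 8"
| "symbol_code Comma = 9"
| "symbol_code Turnstile = 10"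

text \<open>
  The input word occupies the memory cells from address 0 on, one symbol per cell, and
  its length is in register 0. All other registers and memory cells are 0.
\<close>

definition init_config :: "symbol list \<Rightarrow> config" where
  "init_config w =
     \<lparr>pc = 0,
      regs = (\<lambda>_. 0)(0 := length w),
      mem = (\<lambda>a. if a < length w then symbol_code (w ! a) else 0)\<rparr>"

definition words_below :: "nat \<Rightarrow> config \<Rightarrow> bool" where
  "words_below B c \<longleftrightarrow> (\<forall>r. regs c r < B) \<and> (\<forall>a. mem c a < B)"

definition decides_within :: "program \<Rightarrow> symbol list \<Rightarrow> nat \<Rightarrow> nat \<Rightarrow> bool \<Rightarrow> bool" where
  "decides_within P w T B answer \<longleftrightarrow>
     (\<exists>t \<le> T. halted P (run P t (init_config w)) \<and>
        regs (run P t (init_config w)) 0 = (if answer then 1 else 0) \<and>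
        (\<forall>s \<le> t. words_below B (run P s (init_config w))))"

text \<open>
  Words below \<open>(n + 2) ^ k\<close> are those of \<open>O(log n)\<close> bits; the summand 2 makes sure that
  the bound can exceed any given constant also for small \<open>n\<close>.
\<close>

definition linear_time_decidable ::
  "('i \<Rightarrow> symbol list) \<Rightarrow> ('i \<Rightarrow> nat) \<Rightarrow> ('i \<Rightarrow> bool) \<Rightarrow> bool" where
  "linear_time_decidable enc len Q \<longleftrightarrow>
     (\<exists>P c k. \<forall>x. decides_within P (enc x) (c * len x) ((len x + 2) ^ k) (Q x))"

end

theory Submission
  imports Defs
begin

text \<open>
  A derivation can be confined to any subterm-closed set containing the hypotheses, the
  conclusion and \<open>Top\<close>, so derivability is the closure of the hypotheses under Horn clauses, a bounded
  number for each compound infon. In the first phase the machine parses the input with a stack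
  and gives equal infons equal numbers; as addresses may be polynomially large, a table
  indexed by pairs of numbers replaces hashing. Every compound infon is entered in the watch lists of
  itself, its two operands and \<open>Bot\<close>. The second phase derives infons with a queue: whenever an
  infon is taken from the queue, the rules are applied to all infons in its watch list. The total
  length of the watch lists is linear, and so is the running time.
\<close>

section \<open>Locality of derivations\<close>

text \<open>The calculus is local because implication introduction discharges no hypothesis: every
  rule instance is a Horn clause about one compound, its operands and possibly \<open>Bot\<close>.
  The weak bottom rule is what makes \<open>Bot\<close> a premise, and hence the reason why
  \<open>Bot\<close> needs a watch list.

  Tables of quadratic size are affordable only because blank memory reads as 0 and is never
  initialised. So 0 must never be the result of a successful lookup; it is reserved for the empty
  atom, which is neither a compound nor an extension of an atom. An atom counts with the length of
  its name, so its name may be read bit by bit, as a path in a trie.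

  The obstacle is that time and word size are claimed for an actual list of instructions. A
  structured language is therefore compiled once and for all: loop-free code is verified by weakest
  preconditions and has a cost independent of the state, and just two loops need a variant. All
  values of the structured program stay below 4n + 16 for an input of length n: there are at most n
  + 3 numbers, and at most 4(n + 3) entries in the watch lists.\<close>

lemma infers_mono: "infers S \<phi> \<Longrightarrow> S \<subseteq> S' \<Longrightarrow> infers S' \<phi>"
  by (induction rule: infers.induct) (auto intro: infers.intros)

lemma is_derivation_append:
  assumes "is_derivation \<Gamma> ds" "is_derivation \<Gamma> es"
  shows "is_derivation \<Gamma> (ds @ es)"
  unfolding is_derivation_def
proof (intro allI impI)
  fix i assume i: "i < length (ds @ es)"
  show "(ds @ es) ! i \<in> \<Gamma> \<union> {Top} \<or> infers (set (take i (ds @ es))) ((ds @ es) ! i)"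
  proof (cases "i < length ds")
    case True then show ?thesis using assms(1) by (auto simp: is_derivation_def nth_append)
  next
    case False
    then have "es ! (i - length ds) \<in> \<Gamma> \<union> {Top} \<or>
        infers (set (take (i - length ds) es)) (es ! (i - length ds))"
      using assms(2) i by (simp add: is_derivation_def)
    moreover have "set (take (i - length ds) es) \<subseteq> set (take i (ds @ es))" by auto
    ultimately show ?thesis using False infers_mono by (metis nth_append)
  qed
qed

lemma is_derivation_snoc:
  assumes "is_derivation \<Gamma> ds" "\<phi> \<in> \<Gamma> \<union> {Top} \<or> infers (set ds) \<phi>"
  shows "is_derivation \<Gamma> (ds @ [\<phi>])"
  using assms by (auto simp: is_derivation_def nth_append less_Suc_eq)

lemma derives_axiom: "\<phi> \<in> \<Gamma> \<union> {Top} \<Longrightarrow> \<Gamma> \<turnstile> \<phi>"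
  unfolding derives_def is_derivation_def by (intro exI[of _ "[\<phi>]"]) auto

lemma derivation_of_finite:
  assumes "finite S" "\<forall>\<psi>\<in>S. \<Gamma> \<turnstile> \<psi>"
  shows "\<exists>ds. is_derivation \<Gamma> ds \<and> S \<subseteq> set ds"
  using assms
proof (induction S)
  case empty then show ?case by (intro exI[of _ "[]"]) (simp add: is_derivation_def)
next
  case (insert \<psi> S)
  then obtain ds es where "is_derivation \<Gamma> ds" "S \<subseteq> set ds" "is_derivation \<Gamma> es" "es \<noteq> []" "last es = \<psi>"
    by (auto simp: derives_def)
  then show ?case using is_derivation_append last_in_set by (intro exI[of _ "ds @ es"]) fastforce
qed

text \<open>A derivation is a finite list and need not contain all derivable infons at once. A rule
  uses at most two premises, so \<open>derives_step\<close> has to concatenate only finitely many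
  derivations.\<close>

lemma infers_finite: "infers S \<phi> \<Longrightarrow> \<exists>S'\<subseteq>S. finite S' \<and> infers S' \<phi>"
proof (induction rule: infers.induct)
  case (conj_intro \<phi>1 \<phi>2)
  then show ?case by (intro exI[of _ "{\<phi>1, \<phi>2}"]) (auto intro: infers.intros)
next
  case (conj_elim1 \<phi>1 \<phi>2)
  then show ?case by (intro exI[of _ "{Conj \<phi>1 \<phi>2}"]) (auto intro: infers.intros)
next
  case (conj_elim2 \<phi>1 \<phi>2)
  then show ?case by (intro exI[of _ "{Conj \<phi>1 \<phi>2}"]) (auto intro: infers.intros)
next
  case (imp_intro \<phi>2 \<phi>1)
  then show ?case by (intro exI[of _ "{\<phi>2}"]) (auto intro: infers.intros)
next
  case (imp_elim \<phi>1 \<phi>2)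
  then show ?case by (intro exI[of _ "{\<phi>1, Imp \<phi>1 \<phi>2}"]) (auto intro: infers.intros)
next
  case (weak_bot \<phi> \<psi>)
  then show ?case by (intro exI[of _ "{Bot, Imp \<phi> \<psi>}"]) (auto intro: infers.intros)
qed

lemma derives_step: "infers {\<psi>. \<Gamma> \<turnstile> \<psi>} \<phi> \<Longrightarrow> \<Gamma> \<turnstile> \<phi>"
proof -
  assume "infers {\<psi>. \<Gamma> \<turnstile> \<psi>} \<phi>"
  then obtain S where S: "S \<subseteq> {\<psi>. \<Gamma> \<turnstile> \<psi>}" "finite S" "infers S \<phi>"
    using infers_finite by blast
  then obtain ds where "is_derivation \<Gamma> ds" "S \<subseteq> set ds"
    using derivation_of_finite[of S \<Gamma>] by auto
  then have "is_derivation \<Gamma> (ds @ [\<phi>])" using S infers_mono is_derivation_snoc by blast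
  then show ?thesis unfolding derives_def by (intro exI[of _ "ds @ [\<phi>]"]) simp
qed

text \<open>Rule induction for derivations given as lists. A rule may cite any earlier member, hence
  course-of-values induction on the position.\<close>

lemma derives_induct [consumes 1, case_names axiom rule]:
  assumes "\<Gamma> \<turnstile> \<phi>" and ax: "\<And>\<psi>. \<psi> \<in> \<Gamma> \<union> {Top} \<Longrightarrow> T \<psi>"
    and step: "\<And>\<psi>. infers {\<chi>. T \<chi>} \<psi> \<Longrightarrow> T \<psi>"
  shows "T \<phi>"
proof -
  obtain ds where ds: "ds \<noteq> []" "last ds = \<phi>" "is_derivation \<Gamma> ds"
    using assms(1) by (auto simp: derives_def)
  have "T (ds ! i)" if "i < length ds" for i
    using that
  proof (induction i rule: less_induct)
    case (less i)
    have "set (take i ds) \<subseteq> {\<chi>. T \<chi>}" using less by (auto simp: set_conv_nth)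
    then show ?case using ds(3) less.prems ax step infers_mono unfolding is_derivation_def by metis
  qed
  then show ?thesis using ds by (metis last_conv_nth length_greater_0_conv diff_less zero_less_one)
qed

section \<open>Renaming of atoms\<close>

lemma infers_map:
  "infers S \<phi> \<Longrightarrow> infers (map_infon f ` S) (map_infon f \<phi>)"
  by (induction rule: infers.induct) (force intro: infers.intros)+

lemma derives_map: "\<Gamma> \<turnstile> \<phi> \<Longrightarrow> map_infon f ` \<Gamma> \<turnstile> map_infon f \<phi>"
proof (induction rule: derives_induct)
  case (axiom \<psi>)
  then show ?case by (auto intro!: derives_axiom)
next
  case (rule \<psi>)
  have "map_infon f ` {\<chi>. map_infon f ` \<Gamma> \<turnstile> map_infon f \<chi>} \<subseteq> {\<chi>. map_infon f ` \<Gamma> \<turnstile> \<chi>}" by auto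
  then show ?case using infers_map[OF rule, of f] infers_mono derives_step by blast
qed

text \<open>The machine sees atoms only through their names. An injective renaming has a left
  inverse, along which a derivation is carried back.\<close>

lemma derives_map_iff:
  assumes "inj f"
  shows "map_infon f ` \<Gamma> \<turnstile> map_infon f \<phi> \<longleftrightarrow> \<Gamma> \<turnstile> \<phi>"
proof
  have *: "map_infon (inv f) (map_infon f \<psi>) = \<psi>" for \<psi> :: "'a infon"
    using assms by (simp add: infon.map_comp infon.map_id0)
  assume "map_infon f ` \<Gamma> \<turnstile> map_infon f \<phi>"
  from derives_map[OF this, of "inv f"] show "\<Gamma> \<turnstile> \<phi>" by (simp add: * image_image)
qed (rule derives_map)

section \<open>Subterm-closed sets and locality\<close>

definition subterm_closed :: "'a infon set \<Rightarrow> bool" where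
  "subterm_closed S \<longleftrightarrow>
     (\<forall>x y. Conj x y \<in> S \<longrightarrow> x \<in> S \<and> y \<in> S) \<and> (\<forall>x y. Imp x y \<in> S \<longrightarrow> x \<in> S \<and> y \<in> S)"

text \<open>Each rule instance is charged to the one compound that it introduces or eliminates, so
  closure of \<open>M\<close> under all rules splits into one condition per compound. The
  implication clause covers modus ponens and the weak bottom rule together.\<close>

fun closed_at :: "'a infon set \<Rightarrow> 'a infon \<Rightarrow> bool" where
  "closed_at M (Conj x y) \<longleftrightarrow> (Conj x y \<in> M \<longleftrightarrow> x \<in> M \<and> y \<in> M)"
| "closed_at M (Imp x y) \<longleftrightarrow>
     (y \<in> M \<longrightarrow> Imp x y \<in> M) \<and> (Imp x y \<in> M \<and> (x \<in> M \<or> Bot \<in> M) \<longrightarrow> y \<in> M)"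
| "closed_at M x \<longleftrightarrow> True"

text \<open>
  A valuation of all infons that agrees with membership in \<open>M\<close> on \<open>S\<close> and satisfies all
  rules; it shows that infons outside the subterm-closed set \<open>S\<close> do not help to derive
  infons in \<open>S\<close>.
\<close>

fun extension :: "'a infon set \<Rightarrow> 'a infon set \<Rightarrow> 'a infon \<Rightarrow> bool" where
  "extension S M (Conj x y) =
     (if Conj x y \<in> S then Conj x y \<in> M else extension S M x \<and> extension S M y)"
| "extension S M (Imp x y) = (if Imp x y \<in> S then Imp x y \<in> M else extension S M y)"
| "extension S M x \<longleftrightarrow> x = Top \<or> x \<in> M"

lemma derives_in_closed:
  assumes S: "subterm_closed S" "M \<subseteq> S" "\<Gamma> \<union> {Top} \<subseteq> M" "\<forall>z\<in>S. closed_at M z"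
    and "\<phi> \<in> S" "\<Gamma> \<turnstile> \<phi>"
  shows "\<phi> \<in> M"
proof -
  have ext: "extension S M x \<longleftrightarrow> x \<in> M" if "x \<in> S" for x
    using that S(3) by (cases x) auto
  have Bot: "extension S M Bot \<longleftrightarrow> Bot \<in> M" by simp
  have conj: "extension S M (Conj x y) \<longleftrightarrow> extension S M x \<and> extension S M y" for x y
  proof (cases "Conj x y \<in> S")
    case True
    then have "x \<in> S" "y \<in> S" "closed_at M (Conj x y)"
      using S(1,4) unfolding subterm_closed_def by blast+
    then show ?thesis using ext True by simp
  qed simp
  \<comment> \<open>Outside \<open>S\<close> an implication has the value of its conclusion, so
    introduction, elimination and the weak bottom rule hold trivially there.\<close>
  have imp: "(extension S M y \<longrightarrow> extension S M (Imp x y)) \<and>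
    (extension S M (Imp x y) \<and> (extension S M x \<or> Bot \<in> M) \<longrightarrow> extension S M y)" for x y
  proof (cases "Imp x y \<in> S")
    case True
    then have "x \<in> S" "y \<in> S" "closed_at M (Imp x y)"
      using S(1,4) unfolding subterm_closed_def by blast+
    then show ?thesis using ext True by simp
  qed simp
  have "extension S M \<phi>"
    using assms(6)
  proof (induction rule: derives_induct)
    case (axiom \<psi>)
    then have "\<psi> \<in> M" using S by blast
    then show ?case using ext S by blast
  next
    case (rule \<psi>)
    then show ?case
      by cases (use conj imp Bot in \<open>blast+\<close>)
  qed
  then show ?thesis using ext assms by blast
qed

section \<open>A structured language for the random access machine\<close>

datatype operand = Reg nat | Lit nat

datatype test = Lt operand operand | Eq operand operand

datatype com =
    Skip
  | Set nat operand
  | Plus nat operand operand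
  | Minus nat operand operand
  | Get nat nat operand operand
  | Put nat operand operand operand
  | Inp nat operand
  | Seq com com  (infixr ";;" 60)
  | Cond test com com
  | While test com

type_synonym regfile = "nat \<Rightarrow> nat"
type_synonym arrays = "nat \<Rightarrow> nat \<Rightarrow> nat \<Rightarrow> nat"

fun val :: "regfile \<Rightarrow> operand \<Rightarrow> nat" where
  "val R (Reg r) = R r"
| "val R (Lit k) = k"

text \<open>The bound 16 fits the assumption \<open>16 \<le> N\<close> of the locale
  \<open>ram\<close>: literals lie below \<open>N\<close>, just as register values do.\<close>

fun lit_ok :: "operand \<Rightarrow> bool" where
  "lit_ok (Reg r) = True"
| "lit_ok (Lit k) = (k < 16)"

fun holds :: "regfile \<Rightarrow> test \<Rightarrow> bool" where
  "holds R (Lt a b) = (val R a < val R b)"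
| "holds R (Eq a b) = (val R a = val R b)"

fun test_ok :: "test \<Rightarrow> bool" where
  "test_ok (Lt a b) = (lit_ok a \<and> lit_ok b)"
| "test_ok (Eq a b) = (lit_ok a \<and> lit_ok b)"

definition put :: "nat \<Rightarrow> nat \<Rightarrow> nat \<Rightarrow> nat \<Rightarrow> arrays \<Rightarrow> arrays" where
  "put k a b v A = A(k := (A k)(a := (A k a)(b := v)))"

text \<open>
  Machine register 1 holds the bound \<open>N\<close> on all values of the structured program, the
  registers 2 and 3 are scratch, and register \<open>r\<close> of the structured program is the machine
  register \<open>r + 6\<close>. The entry with index \<open>a\<close>, \<open>b\<close> of array \<open>k\<close> has the address
  \<open>(a * N + b) * 16 + k + N\<close>, which lies beyond the input.
\<close>

fun fetch :: "nat \<Rightarrow> operand \<Rightarrow> instr" where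
  "fetch t (Reg r) = Move t (r + 6)"
| "fetch t (Lit k) = Const t k"

definition addr_code :: "nat \<Rightarrow> operand \<Rightarrow> operand \<Rightarrow> instr list" where
  "addr_code k a b =
     [fetch 2 a, fetch 3 b, Mul 2 2 1, Add 2 2 3, Const 3 16, Mul 2 2 3, Const 3 k, Add 2 2 3,
      Add 2 2 1]"

fun branch :: "test \<Rightarrow> nat \<Rightarrow> instr list" where
  "branch (Lt a b) l = [fetch 2 a, fetch 3 b, JumpLess 2 3 l]"
| "branch (Eq a b) l = [fetch 2 a, fetch 3 b, JumpEq 2 3 l]"

fun code_length :: "com \<Rightarrow> nat" where
  "code_length Skip = 0"
| "code_length (Set r a) = 1"
| "code_length (Plus r a b) = 3"
| "code_length (Minus r a b) = 3"
| "code_length (Get r k a b) = 10"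
| "code_length (Put k a b v) = 11"
| "code_length (Inp r a) = 2"
| "code_length (c ;; d) = code_length c + code_length d"
| "code_length (Cond t c d) = 4 + code_length c + code_length d"
| "code_length (While t c) = 5 + code_length c"

text \<open>Jump targets are absolute, hence the start address \<open>p\<close>. A branch jumps when
  its test succeeds, so the else part is placed first and needs the jump over the then part.\<close>

fun compile :: "nat \<Rightarrow> com \<Rightarrow> instr list" where
  "compile p Skip = []"
| "compile p (Set r a) = [fetch (r + 6) a]"
| "compile p (Plus r a b) = [fetch 2 a, fetch 3 b, Add (r + 6) 2 3]"
| "compile p (Minus r a b) = [fetch 2 a, fetch 3 b, Sub (r + 6) 2 3]"
| "compile p (Get r k a b) = addr_code k a b @ [Load (r + 6) 2]"
| "compile p (Put k a b v) = addr_code k a b @ [fetch 3 v, Store 2 3]"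
| "compile p (Inp r a) = [fetch 2 a, Load (r + 6) 2]"
| "compile p (c ;; d) = compile p c @ compile (p + code_length c) d"
| "compile p (Cond t c d) =
     branch t (p + 4 + code_length d) @ compile (p + 3) d @
     Jump (p + 4 + code_length d + code_length c) # compile (p + 4 + code_length d) c"
| "compile p (While t c) =
     branch t (p + 4) @ Jump (p + 5 + code_length c) # compile (p + 4) c @ [Jump p]"

lemma length_branch [simp]: "length (branch t l) = 3"
  by (cases t) auto

lemma length_addr_code [simp]: "length (addr_code k a b) = 9"
  by (simp add: addr_code_def)

lemma length_compile [simp]: "length (compile p c) = code_length c"
  by (induction c arbitrary: p) auto

text \<open>An upper bound independent of the state: a conditional is charged with both branches. It
  serves loop-free code; the time of a loop comes from its variant.\<close>

fun cost :: "com \<Rightarrow> nat" where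
  "cost (c ;; d) = cost c + cost d"
| "cost (Cond t c d) = 4 + cost c + cost d"
| "cost c = code_length c"

section \<open>Runs of code placed inside a program\<close>

definition code_at :: "program \<Rightarrow> nat \<Rightarrow> instr list \<Rightarrow> bool" where
  "code_at P p is \<longleftrightarrow> (\<exists>xs ys. P = xs @ is @ ys \<and> length xs = p)"

lemma code_at_append:
  assumes "code_at P p (xs @ ys)"
  shows "code_at P p xs" "code_at P (p + length xs) ys"
proof -
  obtain us vs where *: "P = us @ (xs @ ys) @ vs" "length us = p"
    using assms unfolding code_at_def by blast
  from * show "code_at P p xs" unfolding code_at_def by auto
  have "P = (us @ xs) @ ys @ vs" "length (us @ xs) = p + length xs" using * by auto
  then show "code_at P (p + length xs) ys" unfolding code_at_def by blast
qed

lemma code_at_Cons: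
  assumes "code_at P p (i # is)"
  shows "p < length P" "P ! p = i" "code_at P (Suc p) is"
  using assms code_at_append(2)[of P p "[i]" "is"] unfolding code_at_def[of P p] by auto

text \<open>The word bound is imposed on every intermediate configuration, because
  \<open>decides_within\<close> limits the whole run and not only its end.\<close>

definition reaches :: "program \<Rightarrow> nat \<Rightarrow> config \<Rightarrow> nat \<Rightarrow> config \<Rightarrow> bool" where
  "reaches P B c t c' \<longleftrightarrow> run P t c = c' \<and> (\<forall>s\<le>t. words_below B (run P s c))"

lemma run_add: "run P (s + t) c = run P t (run P s c)"
  by (induction t) (simp_all add: run_def)

lemma reaches_refl: "words_below B c \<Longrightarrow> reaches P B c 0 c"
  by (simp add: reaches_def run_def)

lemma reaches_trans:
  assumes "reaches P B c s c'" "reaches P B c' t c''"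
  shows "reaches P B c (s + t) c''"
  unfolding reaches_def
proof (intro conjI allI impI)
  show "run P (s + t) c = c''" using assms by (simp add: reaches_def run_add)
  fix u assume u: "u \<le> s + t"
  show "words_below B (run P u c)"
  proof (cases "u \<le> s")
    case True then show ?thesis using assms by (simp add: reaches_def)
  next
    case False
    then have "run P u c = run P (u - s) c'" using assms run_add[of P s "u - s" c]
      by (simp add: reaches_def)
    then show ?thesis using assms u by (simp add: reaches_def)
  qed
qed

lemma reaches_step:
  assumes "words_below B c" "pc c < length P" "words_below B (exec (P ! pc c) c)"
  shows "reaches P B c 1 (exec (P ! pc c) c)"
proof -
  have "s = 0 \<or> s = 1" if "s \<le> 1" for s :: nat using that by auto
  moreover have "run P 0 c = c" "run P 1 c = exec (P ! pc c) c"
    using assms by (auto simp: run_def step_def halted_def)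
  ultimately show ?thesis using assms by (metis reaches_def order_refl)
qed

fun is_jump :: "instr \<Rightarrow> bool" where
  "is_jump (Jump l) = True"
| "is_jump (JumpLess r s l) = True"
| "is_jump (JumpEq r s l) = True"
| "is_jump _ = False"

fun stays_below :: "nat \<Rightarrow> instr list \<Rightarrow> config \<Rightarrow> bool" where
  "stays_below B [] c = True"
| "stays_below B (i # is) c = (words_below B (exec i c) \<and> stays_below B is (exec i c))"

lemma pc_exec: "\<not> is_jump i \<Longrightarrow> pc (exec i c) = Suc (pc c)"
  by (cases i) auto

lemma reaches_straight:
  assumes "code_at P (pc c) is" "\<forall>i\<in>set is. \<not> is_jump i" "words_below B c" "stays_below B is c"
  shows "reaches P B c (length is) (fold exec is c) \<and> pc (fold exec is c) = pc c + length is"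
  using assms
proof (induction "is" arbitrary: c)
  case Nil then show ?case by (simp add: reaches_refl)
next
  case (Cons i "is")
  note * = code_at_Cons[OF Cons.prems(1)]
  have 1: "reaches P B c 1 (exec i c)" using reaches_step[of B c P] * Cons.prems by simp
  have "reaches P B (exec i c) (length is) (fold exec is (exec i c)) \<and>
      pc (fold exec is (exec i c)) = pc (exec i c) + length is"
    using Cons * by (intro Cons.IH) (auto simp: pc_exec)
  then show ?case using reaches_trans[OF 1] Cons.prems by (auto simp: pc_exec)
qed

text \<open>\<open>N\<close> bounds all values, is the row length of the arrays and, by
  \<open>n \<le> N\<close>, an offset that keeps the arrays clear of the input. All addresses in use
  are below \<open>16 * N * N + N\<close>, which explains the condition on \<open>B\<close>.\<close>

locale ram =
  fixes N B n :: nat and inp :: "nat \<Rightarrow> nat"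
  assumes N_ge: "16 \<le> N" and n_le: "n \<le> N" and B_ge: "16 * N * N + N \<le> B"
    and inp_less: "i < n \<Longrightarrow> inp i < N"
begin

definition addr :: "nat \<Rightarrow> nat \<Rightarrow> nat \<Rightarrow> nat" where
  "addr k a b = (a * N + b) * 16 + k + N"

lemma addr_inj:
  assumes "addr k a b = addr k' a' b'" "k < 16" "k' < 16" "b < N" "b' < N"
  shows "k = k' \<and> a = a' \<and> b = b'"
proof -
  have *: "(a * N + b) * 16 + k = (a' * N + b') * 16 + k'" using assms by (simp add: addr_def)
  have "((a * N + b) * 16 + k) mod 16 = k" "((a' * N + b') * 16 + k') mod 16 = k'"
    using assms by (simp_all only: mod_mult_self3 mod_less)
  then have k: "k = k'" using * by simp
  then have **: "a * N + b = a' * N + b'" using * by simp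
  have "(a * N + b) div N = a" "(a' * N + b') div N = a'" using assms N_ge by auto
  then have "a = a'" using ** by simp
  then show ?thesis using k ** by simp
qed

lemma addr_bound:
  assumes "k < 16" "a < N" "b < N"
  shows "addr k a b < B"
proof -
  have "a * N + b < N * N"
  proof -
    have "a * N + N \<le> N * N" using assms by (metis Suc_leI add.commute mult_Suc mult_le_mono1)
    then show ?thesis using assms by linarith
  qed
  then show ?thesis using assms B_ge unfolding addr_def by (simp add: mult.assoc)
qed

section \<open>Represented states, weakest preconditions and timed triples\<close>

definition bounded :: "regfile \<Rightarrow> arrays \<Rightarrow> bool" where
  "bounded R A \<longleftrightarrow> (\<forall>r. R r < N) \<and> (\<forall>k a b. A k a b < N)"

text \<open>Arrays are total functions, but only entries with indices below \<open>N\<close> have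
  cells. Since \<open>bounded\<close> keeps all operands below \<open>N\<close>, no access leaves
  this range.\<close>

definition rep :: "regfile \<Rightarrow> arrays \<Rightarrow> config \<Rightarrow> bool" where
  "rep R A c \<longleftrightarrow> bounded R A \<and> words_below B c \<and> regs c 1 = N \<and>
     (\<forall>r. regs c (r + 6) = R r) \<and>
     (\<forall>k a b. k < 16 \<longrightarrow> a < N \<longrightarrow> b < N \<longrightarrow> mem c (addr k a b) = A k a b) \<and>
     (\<forall>i<n. mem c i = inp i)"

text \<open>Addition carries the only check against \<open>N\<close>: in a represented state the
  other operations cannot produce a larger value, and array indices are in range automatically. The
  value \<open>False\<close> at loops confines the calculus to loop-free code.\<close>

primrec wpc :: "com \<Rightarrow> regfile \<Rightarrow> arrays \<Rightarrow> (regfile \<Rightarrow> arrays \<Rightarrow> bool) \<Rightarrow> bool" where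
  "wpc Skip R A Q = Q R A"
| "wpc (Set r a) R A Q = (lit_ok a \<and> Q (R(r := val R a)) A)"
| "wpc (Plus r a b) R A Q =
     (lit_ok a \<and> lit_ok b \<and> val R a + val R b < N \<and> Q (R(r := val R a + val R b)) A)"
| "wpc (Minus r a b) R A Q = (lit_ok a \<and> lit_ok b \<and> Q (R(r := val R a - val R b)) A)"
| "wpc (Get r k a b) R A Q =
     (k < 16 \<and> lit_ok a \<and> lit_ok b \<and> Q (R(r := A k (val R a) (val R b))) A)"
| "wpc (Put k a b v) R A Q =
     (k < 16 \<and> lit_ok a \<and> lit_ok b \<and> lit_ok v \<and> Q R (put k (val R a) (val R b) (val R v) A))"
| "wpc (Inp r a) R A Q = (lit_ok a \<and> val R a < n \<and> Q (R(r := inp (val R a))) A)"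
| "wpc (c ;; d) R A Q = wpc c R A (\<lambda>R' A'. wpc d R' A' Q)"
| "wpc (Cond t c d) R A Q = (test_ok t \<and> (if holds R t then wpc c R A Q else wpc d R A Q))"
| "wpc (While t c) R A Q = False"

lemma wpc_mono:
  "wpc c R A Q \<Longrightarrow> (\<And>R' A'. Q R' A' \<Longrightarrow> Q' R' A') \<Longrightarrow> wpc c R A Q'"
proof (induction c arbitrary: R A Q Q')
  case (Seq c d)
  have "wpc c R A (\<lambda>R' A'. wpc d R' A' Q)" using Seq.prems by simp
  then have "wpc c R A (\<lambda>R' A'. wpc d R' A' Q')" by (rule Seq.IH(1)) (rule Seq.IH(2)[OF _ Seq.prems(2)])
  then show ?case by simp
qed (auto split: if_splits)

text \<open>Total correctness with a time bound. Quantifying over the surrounding program and over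
  the start address is what lets triples be composed.\<close>

definition tri ::
  "com \<Rightarrow> regfile \<Rightarrow> arrays \<Rightarrow> nat \<Rightarrow> (regfile \<Rightarrow> arrays \<Rightarrow> bool) \<Rightarrow> bool" where
  "tri c R A T Q \<longleftrightarrow>
     (\<forall>P cf. code_at P (pc cf) (compile (pc cf) c) \<longrightarrow> rep R A cf \<longrightarrow>
        (\<exists>t\<le>T. \<exists>R' A' cf'. reaches P B cf t cf' \<and> Q R' A' \<and> rep R' A' cf' \<and>
           pc cf' = pc cf + code_length c))"

lemma triD:
  assumes "tri c R A T Q" "code_at P (pc cf) (compile (pc cf) c)" "rep R A cf"
  obtains t R' A' cf' where "t \<le> T" "reaches P B cf t cf'" "Q R' A'" "rep R' A' cf'"
    "pc cf' = pc cf + code_length c"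
  using assms unfolding tri_def by blast

lemma tri_mono:
  assumes "tri c R A T Q" "T \<le> T'" "\<And>R' A'. Q R' A' \<Longrightarrow> Q' R' A'"
  shows "tri c R A T' Q'"
  using assms unfolding tri_def by (meson order_trans)

lemma tri_Seq:
  assumes c: "tri c R A T Q" and d: "\<And>R' A'. Q R' A' \<Longrightarrow> tri d R' A' T' Q'"
  shows "tri (c ;; d) R A (T + T') Q'"
  unfolding tri_def
proof (intro allI impI)
  fix P :: program and cf :: config
  assume code: "code_at P (pc cf) (compile (pc cf) (c ;; d))" and rep: "rep R A cf"
  from code have code1: "code_at P (pc cf) (compile (pc cf) c)"
    and code2: "code_at P (pc cf + code_length c) (compile (pc cf + code_length c) d)"
    using code_at_append[of P "pc cf" "compile (pc cf) c"] by auto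
  obtain t R1 A1 cf1 where 1: "t \<le> T" "reaches P B cf t cf1" "Q R1 A1" "rep R1 A1 cf1"
    "pc cf1 = pc cf + code_length c" using triD[OF c code1 rep] .
  obtain t' R2 A2 cf2 where 2: "t' \<le> T'" "reaches P B cf1 t' cf2" "Q' R2 A2" "rep R2 A2 cf2"
    "pc cf2 = pc cf1 + code_length d"
    using triD[OF d[OF 1(3)], of P cf1, unfolded 1(5), OF code2 1(4)] unfolding 1(5) .
  have "reaches P B cf (t + t') cf2" using reaches_trans 1 2 by blast
  then show "\<exists>t\<le>T + T'. \<exists>R' A' cf'. reaches P B cf t cf' \<and> Q' R' A' \<and> rep R' A' cf' \<and>
           pc cf' = pc cf + code_length (c ;; d)"
    using 1 2 by (intro exI[of _ "t + t'"] conjI exI[of _ R2] exI[of _ A2] exI[of _ cf2]) simp_all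
qed

lemma words_below_reg:
  "words_below B c \<Longrightarrow> v < B \<Longrightarrow> words_below B (c\<lparr>pc := p, regs := (regs c)(r := v)\<rparr>)"
  by (simp add: words_below_def)

lemma less_B: "v < N \<Longrightarrow> v < B"
  using B_ge by simp

lemma rep_val_less: "rep R A c \<Longrightarrow> lit_ok a \<Longrightarrow> val R a < N"
  using N_ge by (cases a) (auto simp: rep_def bounded_def)

lemma fetch_exec:
  assumes "rep R A c" "lit_ok a"
  shows "exec (fetch t a) c = c\<lparr>pc := pc c + 1, regs := (regs c)(t := val R a)\<rparr>"
  using assms by (cases a) (auto simp: rep_def)

lemma rep_scratch:
  assumes "rep R A c" "t \<noteq> 1" "t < 6" "v < B"
  shows "rep R A (c\<lparr>pc := p, regs := (regs c)(t := v)\<rparr>)"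
  using assms by (auto simp: rep_def words_below_def)

lemma rep_pc: "rep R A c \<Longrightarrow> rep R A (c\<lparr>pc := p\<rparr>)"
  by (auto simp: rep_def words_below_def)

lemma rep_update_reg:
  assumes "rep R A c" "v < N"
  shows "rep (R(r := v)) A (c\<lparr>pc := p, regs := (regs c)(r + 6 := v)\<rparr>)"
  using assms less_B[of v] by (auto simp: rep_def words_below_def bounded_def)

lemma rep_put:
  assumes "rep R A c" "v < N" "k < 16" "a < N" "b < N"
  shows "rep R (put k a b v A) (c\<lparr>pc := p, mem := (mem c)(addr k a b := v)\<rparr>)"
proof -
  have "i \<noteq> addr k a b" if "i < n" for i using that n_le by (simp add: addr_def)
  moreover have "addr k' a' b' = addr k a b \<longleftrightarrow> k' = k \<and> a' = a \<and> b' = b"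
    if "k' < 16" "b' < N" for k' a' b' using addr_inj that assms by blast
  ultimately show ?thesis using assms less_B[of v]
    by (auto simp: rep_def words_below_def bounded_def put_def)
qed

lemma stays_below_append:
  "stays_below B (xs @ ys) c \<longleftrightarrow> stays_below B xs c \<and> stays_below B ys (fold exec xs c)"
  by (induction xs arbitrary: c) auto

lemma rep_words_below: "rep R A c \<Longrightarrow> words_below B c"
  by (simp add: rep_def)

lemma fetch2_exec:
  assumes rep: "rep R A c" and ok: "lit_ok a" "lit_ok b"
  defines "c' \<equiv> exec (fetch 3 b) (exec (fetch 2 a) c)"
  shows "words_below B (exec (fetch 2 a) c)" "rep R A c'"
    "regs c' 2 = val R a" "regs c' 3 = val R b"
proof -
  let ?c1 = "exec (fetch 2 a) c"
  have B: "val R a < B" "val R b < B" using rep_val_less[OF rep] ok less_B by auto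
  have 1: "rep R A ?c1" unfolding fetch_exec[OF rep ok(1)]
    using rep_scratch[OF rep, of 2] B by simp
  then show "words_below B ?c1" by (rule rep_words_below)
  show "rep R A c'" unfolding c'_def fetch_exec[OF 1 ok(2)]
    using rep_scratch[OF 1, of 3] B by simp
  show "regs c' 2 = val R a" "regs c' 3 = val R b"
    unfolding c'_def fetch_exec[OF 1 ok(2)] unfolding fetch_exec[OF rep ok(1)] by simp_all
qed

lemma scratch_exec:
  assumes rep: "rep R A c" and v: "v < B"
    and i: "exec i c = c\<lparr>pc := pc c + 1, regs := (regs c)(t := v)\<rparr>" "t = 2 \<or> t = 3"
  shows "rep R A (exec i c)" "words_below B (exec i c)"
    "regs (exec i c) 2 = (if t = 2 then v else regs c 2)"
    "regs (exec i c) 3 = (if t = 3 then v else regs c 3)"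
proof -
  show "rep R A (exec i c)" unfolding i(1) using rep_scratch[OF rep _ _ v, of t] i(2) by auto
  then show "words_below B (exec i c)" by (rule rep_words_below)
qed (use i in auto)

lemma addr_code_exec:
  assumes rep: "rep R A c" and ok: "k < 16" "lit_ok a" "lit_ok b"
  defines "c' \<equiv> fold exec (addr_code k a b) c"
  shows "stays_below B (addr_code k a b) c" "rep R A c'" "regs c' 2 = addr k (val R a) (val R b)"
proof -
  \<comment> \<open>Every intermediate value of the address computation is at most the final address
    or one of the constants 16 and \<open>k\<close>. Hiding the product behind \<open>p\<close>
    makes these bounds linear.\<close>
  have v: "val R a < N" "val R b < N" using rep_val_less rep ok by auto
  have "addr k (val R a) (val R b) < B" by (rule addr_bound) (use ok v in auto)
  moreover define p where "p = val R a * N"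
  ultimately have "(p + val R b) * 16 + k + N < B" by (simp only: addr_def)
  then have "p < B" "p + val R b < B" "(p + val R b) * 16 < B" "(p + val R b) * 16 + k < B"
    "(p + val R b) * 16 + k + N < B" "16 < B" "k < B"
    using ok N_ge by auto
  note bounds = this[unfolded p_def]
  define c2 where "c2 = exec (fetch 3 b) (exec (fetch 2 a) c)"
  define c3 where "c3 = exec (Mul 2 2 1) c2"
  define c4 where "c4 = exec (Add 2 2 3) c3"
  define c5 where "c5 = exec (Const 3 16) c4"
  define c6 where "c6 = exec (Mul 2 2 3) c5"
  define c7 where "c7 = exec (Const 3 k) c6"
  define c8 where "c8 = exec (Add 2 2 3) c7"
  define c9 where "c9 = exec (Add 2 2 1) c8"
  have N: "rep R A c0 \<Longrightarrow> regs c0 1 = N" for c0 by (simp add: rep_def)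
  note 2 = fetch2_exec[OF rep ok(2,3), folded c2_def]
  have 3: "rep R A c3" "words_below B c3" "regs c3 2 = val R a * N" "regs c3 3 = val R b"
    unfolding c3_def
    using scratch_exec[OF 2(2) bounds(1), of "Mul 2 2 1" 2] 2 N[OF 2(2)] by simp_all
  have 4: "rep R A c4" "words_below B c4" "regs c4 2 = val R a * N + val R b"
    unfolding c4_def using scratch_exec[OF 3(1) bounds(2), of "Add 2 2 3" 2] 3 by simp_all
  have 5: "rep R A c5" "words_below B c5" "regs c5 2 = val R a * N + val R b" "regs c5 3 = 16"
    unfolding c5_def using scratch_exec[OF 4(1) bounds(6), of "Const 3 16" 3] 4 by simp_all
  have 6: "rep R A c6" "words_below B c6" "regs c6 2 = (val R a * N + val R b) * 16"
    unfolding c6_def using scratch_exec[OF 5(1) bounds(3), of "Mul 2 2 3" 2] 5 by simp_all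
  have 7: "rep R A c7" "words_below B c7" "regs c7 2 = (val R a * N + val R b) * 16" "regs c7 3 = k"
    unfolding c7_def using scratch_exec[OF 6(1) bounds(7), of "Const 3 k" 3] 6 by simp_all
  have 8: "rep R A c8" "words_below B c8" "regs c8 2 = (val R a * N + val R b) * 16 + k"
    unfolding c8_def using scratch_exec[OF 7(1) bounds(4), of "Add 2 2 3" 2] 7 by simp_all
  have 9: "rep R A c9" "words_below B c9" "regs c9 2 = (val R a * N + val R b) * 16 + k + N"
    unfolding c9_def
    using scratch_exec[OF 8(1) bounds(5), of "Add 2 2 1" 2] 8 N[OF 8(1)] by simp_all
  have c': "c' = c9"
    by (simp add: c'_def addr_code_def c2_def c3_def c4_def c5_def c6_def c7_def c8_def c9_def
        del: exec.simps)
  show "rep R A c'" "regs c' 2 = addr k (val R a) (val R b)"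
    using 9 by (simp_all only: c' addr_def)
  show "stays_below B (addr_code k a b) c"
    using 2(1) rep_words_below[OF 2(2)] 3(2) 4(2) 5(2) 6(2) 7(2) 8(2) 9(2)
    by (simp add: addr_code_def c2_def c3_def c4_def c5_def c6_def c7_def c8_def c9_def
        del: exec.simps)
qed

lemma tri_straight:
  assumes "\<And>p. compile p c = is" "\<forall>i\<in>set is. \<not> is_jump i"
    and "\<And>cf. rep R A cf \<Longrightarrow>
      stays_below B is cf \<and> (\<exists>R' A'. Q R' A' \<and> rep R' A' (fold exec is cf))"
  shows "tri c R A (length is) Q"
  unfolding tri_def
proof (intro allI impI)
  fix P :: program and cf :: config
  assume code: "code_at P (pc cf) (compile (pc cf) c)" and rep: "rep R A cf"
  have "reaches P B cf (length is) (fold exec is cf) \<and>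
      pc (fold exec is cf) = pc cf + length is"
    using code rep assms by (intro reaches_straight) (auto simp: rep_def)
  moreover have "code_length c = length is" using assms(1) length_compile by metis
  ultimately show "\<exists>t\<le>length is. \<exists>R' A' cf'. reaches P B cf t cf' \<and> Q R' A' \<and> rep R' A' cf' \<and>
           pc cf' = pc cf + code_length c"
    using assms(3)[OF rep] by auto
qed

lemma is_jump_fetch [simp]: "\<not> is_jump (fetch t a)"
  by (cases a) auto

lemma is_jump_addr_code [simp]: "i \<in> set (addr_code k a b) \<Longrightarrow> \<not> is_jump i"
  by (auto simp: addr_code_def)

lemma branch_exec:
  assumes code: "code_at P (pc cf) (branch t l)" and rep: "rep R A cf" and ok: "test_ok t"
  obtains cf' where "reaches P B cf 3 cf'" "rep R A cf'"
    "pc cf' = (if holds R t then l else pc cf + 3)"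
proof -
  \<comment> \<open>Both conditional jumps touch only the program counter; with this abstraction one
    argument covers both tests.\<close>
  obtain a b j where t: "branch t l = [fetch 2 a, fetch 3 b, j]" "lit_ok a" "lit_ok b"
    and j: "\<And>c. exec j c = c\<lparr>pc := pc (exec j c)\<rparr>"
      "\<And>c. regs c 2 = val R a \<Longrightarrow> regs c 3 = val R b \<Longrightarrow>
        pc (exec j c) = (if holds R t then l else pc c + 1)"
    using ok by (cases t) auto
  let ?c = "exec (fetch 3 b) (exec (fetch 2 a) cf)"
  have f: "words_below B (exec (fetch 2 a) cf)" "rep R A ?c"
    "regs ?c 2 = val R a" "regs ?c 3 = val R b"
    using fetch2_exec[OF rep, of a b] t by auto
  have code': "code_at P (pc cf) [fetch 2 a, fetch 3 b]" "code_at P (pc cf + 2) [j]"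
    using code code_at_append[of P "pc cf" "[fetch 2 a, fetch 3 b]" "[j]"] t by auto
  have 1: "reaches P B cf 2 ?c" "pc ?c = pc cf + 2"
    using reaches_straight[OF code'(1), of B] f rep_words_below[OF f(2)] rep_words_below[OF rep]
    by (auto simp: numeral_2_eq_2)
  have 2: "P ! pc ?c = j" "pc ?c < length P"
    using code_at_Cons[OF code'(2)] 1 by auto
  have 3: "rep R A (exec j ?c)" by (subst j(1)) (rule rep_pc[OF f(2)])
  then have "reaches P B ?c 1 (exec j ?c)"
    using reaches_step 2 f(2) rep_words_below by metis
  from reaches_trans[OF 1(1) this] have "reaches P B cf 3 (exec j ?c)" by simp
  moreover have "pc (exec j ?c) = (if holds R t then l else pc cf + 3)"
    using j(2)[OF f(3,4)] 1 by simp
  ultimately show ?thesis using that 3 by blast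
qed

lemma tri_Cond:
  assumes ok: "test_ok t" and c: "holds R t \<Longrightarrow> tri c R A T Q" and d: "\<not> holds R t \<Longrightarrow> tri d R A T' Q"
  shows "tri (Cond t c d) R A (4 + T + T') Q"
  unfolding tri_def
proof (intro allI impI)
  fix P :: program and cf :: config
  let ?p = "pc cf"
  let ?jmp = "Jump (?p + 4 + code_length d + code_length c)"
  assume "code_at P ?p (compile ?p (Cond t c d))" and rep: "rep R A cf"
  then have code0: "code_at P ?p (branch t (?p + 4 + code_length d) @
      (compile (?p + 3) d @ ?jmp # compile (?p + 4 + code_length d) c))" by simp
  note code1 = code_at_append(2)[OF code0, unfolded length_branch]
  note code = code_at_append(1)[OF code0] code_at_append(1)[OF code1]
    code_at_append(2)[OF code1, unfolded length_compile]
  obtain cf1 where 1: "reaches P B cf 3 cf1" "rep R A cf1"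
    "pc cf1 = (if holds R t then ?p + 4 + code_length d else ?p + 3)"
    using branch_exec[OF code(1) rep ok] by metis
  show "\<exists>t'\<le>4 + T + T'. \<exists>R' A' cf'. reaches P B cf t' cf' \<and> Q R' A' \<and> rep R' A' cf' \<and>
           pc cf' = ?p + code_length (Cond t c d)"
  proof (cases "holds R t")
    case True
    have code_c: "code_at P (pc cf1) (compile (pc cf1) c)"
      using code_at_Cons(3)[OF code(3)] 1 True by (simp add: ac_simps)
    obtain t' R' A' cf' where 2: "t' \<le> T" "reaches P B cf1 t' cf'" "Q R' A'" "rep R' A' cf'"
      "pc cf' = pc cf1 + code_length c" using triD[OF c[OF True] code_c 1(2)] .
    have "reaches P B cf (3 + t') cf'" using reaches_trans 1 2 by blast
    then show ?thesis using 1 2 True by (intro exI[of _ "3 + t'"] conjI exI[of _ R'] exI[of _ A'] exI[of _ cf']) simp_all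
  next
    case False
    then have code_d: "code_at P (pc cf1) (compile (pc cf1) d)" using 1(3) code(2) by simp
    obtain t' R' A' cf' where 2: "t' \<le> T'" "reaches P B cf1 t' cf'" "Q R' A'" "rep R' A' cf'"
      "pc cf' = pc cf1 + code_length d" using triD[OF d[OF False] code_d 1(2)] .
    have 3: "exec (P ! pc cf') cf' = cf'\<lparr>pc := ?p + 4 + code_length d + code_length c\<rparr>"
      "pc cf' < length P" using code_at_Cons[OF code(3)] 1 2 False by auto
    have 4: "rep R' A' (exec (P ! pc cf') cf')" using 2 rep_pc 3 by simp
    have "reaches P B cf' 1 (exec (P ! pc cf') cf')"
      using reaches_step 2 3 4 rep_words_below by blast
    then have "reaches P B cf (3 + t' + 1) (exec (P ! pc cf') cf')"
      using reaches_trans 1 2 by blast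
    then show ?thesis using 2 3 4 False
      by (intro exI[of _ "3 + t' + 1"] conjI exI[of _ R'] exI[of _ A']
          exI[of _ "exec (P ! pc cf') cf'"]) simp_all
  qed
qed

lemma wpc_tri: "wpc c R A Q \<Longrightarrow> tri c R A (cost c) Q"
proof (induction c arbitrary: R A Q)
  case Skip
  then show ?case using reaches_refl rep_words_below by (fastforce simp: tri_def)
next
  case (Set r a)
  have "tri (Set r a) R A (length [fetch (r + 6) a]) Q"
  proof (rule tri_straight)
    fix cf assume rep: "rep R A cf"
    have "rep (R(r := val R a)) A (exec (fetch (r + 6) a) cf)"
      using rep Set rep_update_reg[OF rep] rep_val_less[OF rep] fetch_exec[OF rep] by simp
    then show "stays_below B [fetch (r + 6) a] cf \<and>
        (\<exists>R' A'. Q R' A' \<and> rep R' A' (fold exec [fetch (r + 6) a] cf))"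
      using Set rep_words_below by (auto intro!: exI)
  qed auto
  then show ?case by (simp add: eval_nat_numeral)
next
  case (Plus r a b)
  have "tri (Plus r a b) R A (length [fetch 2 a, fetch 3 b, Add (r + 6) 2 3]) Q"
  proof (rule tri_straight)
    fix cf assume rep: "rep R A cf"
    let ?c = "exec (fetch 3 b) (exec (fetch 2 a) cf)"
    have f: "words_below B (exec (fetch 2 a) cf)" "rep R A ?c"
      "regs ?c 2 = val R a" "regs ?c 3 = val R b"
      using fetch2_exec[OF rep, of a b] Plus by auto
    have "rep (R(r := val R a + val R b)) A (exec (Add (r + 6) 2 3) ?c)"
      using rep_update_reg[OF f(2)] Plus f by simp
    then show "stays_below B [fetch 2 a, fetch 3 b, Add (r + 6) 2 3] cf \<and>
        (\<exists>R' A'. Q R' A' \<and> rep R' A' (fold exec [fetch 2 a, fetch 3 b, Add (r + 6) 2 3] cf))"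
      using Plus rep_words_below f by (auto simp del: exec.simps intro!: exI)
  qed auto
  then show ?case by (simp add: eval_nat_numeral)
next
  case (Minus r a b)
  have "tri (Minus r a b) R A (length [fetch 2 a, fetch 3 b, Sub (r + 6) 2 3]) Q"
  proof (rule tri_straight)
    fix cf assume rep: "rep R A cf"
    let ?c = "exec (fetch 3 b) (exec (fetch 2 a) cf)"
    have f: "words_below B (exec (fetch 2 a) cf)" "rep R A ?c"
      "regs ?c 2 = val R a" "regs ?c 3 = val R b"
      using fetch2_exec[OF rep, of a b] Minus by auto
    have "val R a - val R b < N" using rep_val_less[OF rep, of a] Minus by simp
    then have "rep (R(r := val R a - val R b)) A (exec (Sub (r + 6) 2 3) ?c)"
      using rep_update_reg[OF f(2)] Minus f by simp
    then show "stays_below B [fetch 2 a, fetch 3 b, Sub (r + 6) 2 3] cf \<and>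
        (\<exists>R' A'. Q R' A' \<and> rep R' A' (fold exec [fetch 2 a, fetch 3 b, Sub (r + 6) 2 3] cf))"
      using Minus rep_words_below f by (auto simp del: exec.simps intro!: exI)
  qed auto
  then show ?case by (simp add: eval_nat_numeral)
next
  case (Get r k a b)
  have "tri (Get r k a b) R A (length (addr_code k a b @ [Load (r + 6) 2])) Q"
  proof (rule tri_straight)
    fix cf assume rep: "rep R A cf"
    let ?c = "fold exec (addr_code k a b) cf"
    have f: "stays_below B (addr_code k a b) cf" "rep R A ?c"
      "regs ?c 2 = addr k (val R a) (val R b)"
      using addr_code_exec[OF rep, of k a b] Get by auto
    have v: "val R a < N" "val R b < N" using rep_val_less[OF rep] Get by auto
    then have "mem ?c (regs ?c 2) = A k (val R a) (val R b)" using f Get by (simp add: rep_def)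
    moreover have "A k (val R a) (val R b) < N" using rep by (simp add: rep_def bounded_def)
    ultimately have "rep (R(r := A k (val R a) (val R b))) A (exec (Load (r + 6) 2) ?c)"
      using rep_update_reg[OF f(2)] by simp
    then show "stays_below B (addr_code k a b @ [Load (r + 6) 2]) cf \<and>
        (\<exists>R' A'. Q R' A' \<and> rep R' A' (fold exec (addr_code k a b @ [Load (r + 6) 2]) cf))"
      using Get rep_words_below f
      by (auto simp: stays_below_append simp del: exec.simps intro!: exI)
  qed auto
  then show ?case by (simp add: eval_nat_numeral)
next
  case (Put k a b v)
  have "tri (Put k a b v) R A (length (addr_code k a b @ [fetch 3 v, Store 2 3])) Q"
  proof (rule tri_straight)
    fix cf assume rep: "rep R A cf"
    let ?c = "fold exec (addr_code k a b) cf"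
    let ?c' = "exec (fetch 3 v) ?c"
    have f: "stays_below B (addr_code k a b) cf" "rep R A ?c"
      "regs ?c 2 = addr k (val R a) (val R b)"
      using addr_code_exec[OF rep, of k a b] Put by auto
    have v: "val R a < N" "val R b < N" "val R v < N" using rep_val_less[OF rep] Put by auto
    have c': "?c' = ?c\<lparr>pc := pc ?c + 1, regs := (regs ?c)(3 := val R v)\<rparr>"
      using fetch_exec[OF f(2)] Put by simp
    have rep': "rep R A ?c'" unfolding c' using rep_scratch[OF f(2), of 3] v less_B by simp
    have "regs ?c' 2 = addr k (val R a) (val R b)" "regs ?c' 3 = val R v"
      using f unfolding c' by simp_all
    then have "rep R (put k (val R a) (val R b) (val R v) A) (exec (Store 2 3) ?c')"
      using rep_put[OF rep'] v Put by simp
    then show "stays_below B (addr_code k a b @ [fetch 3 v, Store 2 3]) cf \<and>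
        (\<exists>R' A'. Q R' A' \<and> rep R' A' (fold exec (addr_code k a b @ [fetch 3 v, Store 2 3]) cf))"
      using Put rep_words_below f rep'
      by (auto simp: stays_below_append simp del: exec.simps intro!: exI)
  qed auto
  then show ?case by (simp add: eval_nat_numeral)
next
  case (Inp r a)
  have "tri (Inp r a) R A (length [fetch 2 a, Load (r + 6) 2]) Q"
  proof (rule tri_straight)
    fix cf assume rep: "rep R A cf"
    let ?c = "exec (fetch 2 a) cf"
    have c: "?c = cf\<lparr>pc := pc cf + 1, regs := (regs cf)(2 := val R a)\<rparr>"
      using fetch_exec[OF rep] Inp by simp
    have rep': "rep R A ?c"
      unfolding c using rep_scratch[OF rep, of 2] less_B rep_val_less[OF rep] Inp by simp
    have "regs ?c 2 = val R a" unfolding c by simp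
    moreover have "mem ?c (val R a) = inp (val R a)" using rep' Inp by (auto simp: rep_def)
    ultimately have "rep (R(r := inp (val R a))) A (exec (Load (r + 6) 2) ?c)"
      using rep_update_reg[OF rep'] inp_less Inp by simp
    then show "stays_below B [fetch 2 a, Load (r + 6) 2] cf \<and>
        (\<exists>R' A'. Q R' A' \<and> rep R' A' (fold exec [fetch 2 a, Load (r + 6) 2] cf))"
      using Inp rep_words_below rep' by (auto simp del: exec.simps intro!: exI)
  qed auto
  then show ?case by (simp add: eval_nat_numeral)
next
  case (Seq c d)
  have "tri (c ;; d) R A (cost c + cost d) Q"
  proof (rule tri_Seq)
    show "tri c R A (cost c) (\<lambda>R' A'. wpc d R' A' Q)" using Seq by simp
  qed (rule Seq.IH(2))
  then show ?case by simp
next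
  case (Cond t c d)
  have "tri (Cond t c d) R A (4 + cost c + cost d) Q"
    using Cond by (intro tri_Cond) auto
  then show ?case by simp
qed simp

text \<open>The invariant is indexed by a variant, which counts the remaining iterations.\<close>

lemma tri_While:
  assumes inv: "I m R A" and ok: "test_ok t"
    and body: "\<And>m R A. I m R A \<Longrightarrow> holds R t \<Longrightarrow> wpc c R A (\<lambda>R' A'. \<exists>m'<m. I m' R' A')"
  shows "tri (While t c) R A (m * (cost c + 4) + 4) (\<lambda>R' A'. \<not> holds R' t \<and> (\<exists>m. I m R' A'))"
  using inv
proof (induction m arbitrary: R A rule: less_induct)
  case (less m)
  show ?case
    unfolding tri_def
  proof (intro allI impI)
    fix P :: program and cf :: config
    let ?p = "pc cf"
    let ?goal = "\<exists>u\<le>m * (cost c + 4) + 4. \<exists>R' A' cf'. reaches P B cf u cf' \<and>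
      (\<not> holds R' t \<and> (\<exists>m. I m R' A')) \<and> rep R' A' cf' \<and> pc cf' = ?p + code_length (While t c)"
    assume code0: "code_at P ?p (compile ?p (While t c))" and rep: "rep R A cf"
    then have "code_at P ?p (branch t (?p + 4) @
      (Jump (?p + 5 + code_length c) # compile (?p + 4) c @ [Jump ?p]))" by simp
    note code1 = code_at_append[OF this, unfolded length_branch]
    have "Suc (?p + 3) = ?p + 4" by simp
    note code2 = code_at_Cons[OF code1(2), unfolded this]
    note code = code1(1) code2(1,2) code_at_append(1)[OF code2(3)]
      code_at_append(2)[OF code2(3), unfolded length_compile]
    obtain cf1 where 1: "reaches P B cf 3 cf1" "rep R A cf1"
      "pc cf1 = (if holds R t then ?p + 4 else ?p + 3)"
      using branch_exec[OF code(1) rep ok] by metis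
    show ?goal
    proof (cases "holds R t")
      case False
      then have 3: "exec (P ! pc cf1) cf1 = cf1\<lparr>pc := ?p + 5 + code_length c\<rparr>"
        "pc cf1 < length P" using 1 code by auto
      have 4: "rep R A (exec (P ! pc cf1) cf1)" using 1 rep_pc 3 by simp
      have "reaches P B cf1 1 (exec (P ! pc cf1) cf1)"
        using reaches_step 1 3 4 rep_words_below by blast
      then have "reaches P B cf (3 + 1) (exec (P ! pc cf1) cf1)"
        using reaches_trans 1 by blast
      then show ?thesis using 1 3 4 False less.prems
        by (intro exI[of _ "3 + 1"] conjI exI[of _ R] exI[of _ A]
            exI[of _ "exec (P ! pc cf1) cf1"] exI[of _ m]) simp_all
    next
      case True
      have tri: "tri c R A (cost c) (\<lambda>R' A'. \<exists>m'<m. I m' R' A')"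
        by (rule wpc_tri, rule body) (use less.prems True in auto)
      have code_c: "code_at P (pc cf1) (compile (pc cf1) c)" using 1(3) code(4) True by simp
      obtain u R1 A1 cf2 where 2: "u \<le> cost c" "reaches P B cf1 u cf2" "\<exists>m'<m. I m' R1 A1"
        "rep R1 A1 cf2" "pc cf2 = pc cf1 + code_length c"
        using triD[OF tri code_c 1(2)] .
      then obtain m' where m': "m' < m" "I m' R1 A1" by blast
      let ?cf3 = "exec (P ! pc cf2) cf2"
      have 3: "?cf3 = cf2\<lparr>pc := ?p\<rparr>" "pc cf2 < length P"
        using code_at_Cons[OF code(5)] 1 2 True by auto
      have 4: "rep R1 A1 ?cf3" "pc ?cf3 = ?p" using 2 rep_pc 3 by auto
      have 5: "reaches P B cf2 1 ?cf3"
        using reaches_step 2 3 4 rep_words_below by blast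
      obtain v R' A' cf' where 6: "v \<le> m' * (cost c + 4) + 4" "reaches P B ?cf3 v cf'"
        "\<not> holds R' t \<and> (\<exists>m. I m R' A')" "rep R' A' cf'" "pc cf' = ?p + code_length (While t c)"
        using triD[OF less.IH[OF m'], of P ?cf3, unfolded 4(2), OF code0 4(1)] .
      have "reaches P B cf (3 + u + 1 + v) cf'"
        using reaches_trans 1 2 5 6 by blast
      \<comment> \<open>The overhead of 4 per iteration is three instructions for the test and one
        jump back; the final 4 is the failing test and the jump out. The variant drops by at least
        one, so the time of one iteration is available.\<close>
      moreover have "3 + u + 1 + v \<le> m * (cost c + 4) + 4"
      proof -
        have "Suc m' * (cost c + 4) \<le> m * (cost c + 4)" using m' by (intro mult_le_mono1) simp
        then show ?thesis using 2 6 by simp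
      qed
      ultimately show ?thesis using 6 by blast
    qed
  qed
qed

end

section \<open>Parsing and interning\<close>

type_synonym term_infon = "bool list infon"

type_synonym parse_state = "term_infon \<times> (term_infon \<times> nat) list \<times> term_infon list"

text \<open>\<open>k\<close> is the symbol code of the connective, 3 or 4, and at the same time the
  number of the array that interns its compounds. One argument thus serves both connectives.\<close>

definition join :: "nat \<Rightarrow> 'a infon \<Rightarrow> 'a infon \<Rightarrow> 'a infon" where
  "join k x y = (if k = 3 then Conj x y else Imp x y)"

text \<open>
  A state consists of the infon read last, a stack of left operands together with the code of
  the connective, and the list of hypotheses read so far. Atoms are extended bit by bit;
  the empty atom stands for the absence of an infon.
\<close>

fun parse_step :: "nat \<Rightarrow> parse_state \<Rightarrow> parse_state option" where
  "parse_step s (x, st, hs) =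
     (if s = 1 then Some (Top, st, hs)
      else if s = 2 then Some (Bot, st, hs)
      else if s = 3 \<or> s = 4 then Some (Atom [], (x, s) # st, hs)
      else if s = 6 then
        (case st of [] \<Rightarrow> None | (y, k) # st' \<Rightarrow> Some (join k y x, st', hs))
      else if s = 7 \<or> s = 8 then
        (case x of Atom bs \<Rightarrow> Some (Atom (bs @ [s = 8]), st, hs) | _ \<Rightarrow> None)
      else if s = 9 then Some (Atom [], st, x # hs)
      else Some (x, st, hs))"

fun parse :: "nat list \<Rightarrow> parse_state \<Rightarrow> parse_state option" where
  "parse [] p = Some p"
| "parse (s # ss) p = (case parse_step s p of None \<Rightarrow> None | Some p' \<Rightarrow> parse ss p')"

lemma parse_bits:
  "parse (map symbol_code (map bit_symbol bs') @ ss) (Atom bs, st, hs) =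
     parse ss (Atom (bs @ bs'), st, hs)"
proof (induction bs' arbitrary: bs)
  case (Cons b bs')
  show ?case by (cases b) (simp_all add: Cons[unfolded list.map_comp comp_def] comp_def)
qed simp

text \<open>Stated with a continuation \<open>ss\<close> and an arbitrary stack so that the
  induction applies to operands in the middle of a word. A connective pushes the left operand and
  restores the empty atom; the closing parenthesis pops exactly that entry.\<close>

lemma parse_infon:
  "parse (map symbol_code (write_infon (\<lambda>bs. bs) \<phi>) @ ss) (Atom [], st, hs) =
     parse ss (\<phi>, st, hs)"
proof (induction \<phi> arbitrary: ss st)
  case (Atom bs)
  then show ?case using parse_bits[of bs ss "[]"] by simp
qed (simp_all add: join_def)

lemma parse_hypotheses:
  "parse (map symbol_code (concat (map (\<lambda>\<gamma>. write_infon (\<lambda>bs. bs) \<gamma> @ [Comma]) \<gamma>s)) @ ss)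
     (Atom [], st, hs) = parse ss (Atom [], st, rev \<gamma>s @ hs)"
  by (induction \<gamma>s arbitrary: hs) (simp_all add: parse_infon)

lemma parse_instance:
  "parse (map symbol_code (write_instance (\<lambda>bs. bs) (\<gamma>s, \<phi>))) (Atom [], [], []) =
     Some (\<phi>, [], rev \<gamma>s)"
  using parse_hypotheses[of \<gamma>s "map symbol_code ([Turnstile] @ write_infon (\<lambda>bs. bs) \<phi>)"]
    parse_infon[of \<phi> "[]"]
  by (simp add: write_instance_def)

text \<open>
  The machine interns infons: \<open>S\<close> is the set of the infons interned so far and
  \<open>\<iota>\<close> assigns numbers to them.
  Arrays 3 and 4 map the numbers of two operands to that of their conjunction or implication,
  arrays 7 and 8 the number of an atom to that of its extension by a bit, so that
  equal infons get equal numbers. An entry 0 means that the infon is missing.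
  Arrays 11, 12 and 13 hold operands and connective.
\<close>

locale interned =
  fixes S :: "term_infon set" and \<iota> :: "term_infon \<Rightarrow> nat" and m :: nat and A :: arrays
  assumes inj: "inj_on \<iota> S"
    and less: "u \<in> S \<Longrightarrow> \<iota> u < m"
    and empty: "Atom [] \<in> S" "\<iota> (Atom []) = 0"
    and top: "Top \<in> S" "\<iota> Top = 1"
    and bot: "Bot \<in> S" "\<iota> Bot = 2"
    and join_subterms: "join k x y \<in> S \<Longrightarrow> x \<in> S \<and> y \<in> S"
    and prefix: "Atom (bs @ [c]) \<in> S \<Longrightarrow> Atom bs \<in> S"
    and join_entry: "k \<in> {3, 4} \<Longrightarrow> x \<in> S \<Longrightarrow> y \<in> S \<Longrightarrow>
      A k (\<iota> x) (\<iota> y) = (if join k x y \<in> S then \<iota> (join k x y) else 0)"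
    and join_fresh: "k \<in> {3, 4} \<Longrightarrow> m \<le> a \<or> m \<le> b \<Longrightarrow> A k a b = 0"
    and bit_entry: "k \<in> {7, 8} \<Longrightarrow> Atom bs \<in> S \<Longrightarrow>
      A k (\<iota> (Atom bs)) 0 = (if Atom (bs @ [k = 8]) \<in> S then \<iota> (Atom (bs @ [k = 8])) else 0)"
    and bit_fresh: "k \<in> {7, 8} \<Longrightarrow> m \<le> a \<Longrightarrow> A k a 0 = 0"
    and operands: "k \<in> {3, 4} \<Longrightarrow> join k x y \<in> S \<Longrightarrow>
      A 11 (\<iota> (join k x y)) 0 = \<iota> x \<and> A 12 (\<iota> (join k x y)) 0 = \<iota> y \<and>
      A 13 (\<iota> (join k x y)) 0 = k"

text \<open>Array 14 holds the length and array 15 the entries of the watch list of an infon.\<close>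

definition watched ::
  "term_infon set \<Rightarrow> (term_infon \<Rightarrow> nat) \<Rightarrow> (term_infon \<Rightarrow> term_infon list) \<Rightarrow> arrays \<Rightarrow> bool" where
  "watched S \<iota> wl A \<longleftrightarrow>
     (\<forall>u\<in>S. A 14 (\<iota> u) 0 = length (wl u) \<and> (\<forall>j<length (wl u). A 15 (\<iota> u) j = \<iota> (wl u ! j)) \<and>
        set (wl u) \<subseteq> {z \<in> S. \<exists>k\<in>{3, 4}. \<exists>x y. z = join k x y}) \<and>
     (\<forall>a. a \<notin> \<iota> ` S \<longrightarrow> A 14 a 0 = 0)"

text \<open>The closure condition of a compound mentions only its operands, itself and possibly
  \<open>Bot\<close>. Hence it can be destroyed only when one of these is newly derived, and then
  the compound is found in the watch list of that infon.\<close>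

definition watch_complete :: "term_infon set \<Rightarrow> (term_infon \<Rightarrow> term_infon list) \<Rightarrow> bool" where
  "watch_complete S wl \<longleftrightarrow>
     (\<forall>k\<in>{3, 4}. \<forall>x y. join k x y \<in> S \<longrightarrow>
        (\<forall>u\<in>{x, y, Bot, join k x y}. join k x y \<in> set (wl u)))"

text \<open>Array 6 lists the derived infons, and array 5 is their characteristic function.\<close>

definition queued :: "(term_infon \<Rightarrow> nat) \<Rightarrow> term_infon list \<Rightarrow> arrays \<Rightarrow> nat \<Rightarrow> bool" where
  "queued \<iota> qs A q \<longleftrightarrow>
     q = length qs \<and> (\<forall>a. A 5 a 0 = (if a \<in> \<iota> ` set qs then 1 else 0)) \<and>
     (\<forall>i<length qs. A 6 i 0 = \<iota> (qs ! i))"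

text \<open>The list has its top at the head, the arrays have it at the largest index; hence
  \<open>rev\<close>.\<close>

definition stacked ::
  "term_infon set \<Rightarrow> (term_infon \<Rightarrow> nat) \<Rightarrow> (term_infon \<times> nat) list \<Rightarrow> arrays \<Rightarrow> bool" where
  "stacked S \<iota> st A \<longleftrightarrow>
     (\<forall>(x, k) \<in> set st. x \<in> S \<and> k \<in> {3, 4}) \<and>
     (\<forall>i<length st. A 9 i 0 = \<iota> (fst (rev st ! i)) \<and> A 10 i 0 = snd (rev st ! i))"

section \<open>Stability and extension of the interning tables\<close>

lemma interned_cong:
  assumes "interned S \<iota> m A" "\<And>k. k \<in> {3, 4, 7, 8, 11, 12, 13} \<Longrightarrow> A' k = A k"
  shows "interned S \<iota> m A'"
proof -
  interpret interned S \<iota> m A by fact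
  have "A' 3 = A 3" "A' 4 = A 4" "A' 7 = A 7" "A' 8 = A 8" "A' 11 = A 11" "A' 12 = A 12"
    "A' 13 = A 13" using assms(2) by simp_all
  then have eq: "k \<in> {3, 4} \<Longrightarrow> A' k = A k" "k \<in> {7, 8} \<Longrightarrow> A' k = A k" "A' 11 = A 11"
    "A' 12 = A 12" "A' 13 = A 13" for k :: nat by auto
  show ?thesis
  proof
    fix k :: nat assume k: "k \<in> {3, 4}"
    show "A' k (\<iota> x) (\<iota> y) = (if join k x y \<in> S then \<iota> (join k x y) else 0)"
      if "x \<in> S" "y \<in> S" for x y
      unfolding eq(1)[OF k] by (rule join_entry[OF k that])
    show "A' k a b = 0" if "m \<le> a \<or> m \<le> b" for a b
      unfolding eq(1)[OF k] by (rule join_fresh[OF k that])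
    show "A' 11 (\<iota> (join k x y)) 0 = \<iota> x \<and> A' 12 (\<iota> (join k x y)) 0 = \<iota> y \<and>
      A' 13 (\<iota> (join k x y)) 0 = k" if "join k x y \<in> S" for x y
      unfolding eq(3-5) by (rule operands[OF k that])
  next
    fix k :: nat assume k: "k \<in> {7, 8}"
    show "A' k (\<iota> (Atom bs)) 0 =
        (if Atom (bs @ [k = 8]) \<in> S then \<iota> (Atom (bs @ [k = 8])) else 0)" if "Atom bs \<in> S" for bs
      unfolding eq(2)[OF k] by (rule bit_entry[OF k that])
    show "A' k a 0 = 0" if "m \<le> a" for a
      unfolding eq(2)[OF k] by (rule bit_fresh[OF k that])
  qed (fact inj less empty top bot join_subterms prefix)+
qed

lemma watched_cong:
  "watched S \<iota> wl A \<Longrightarrow> A' 14 = A 14 \<Longrightarrow> A' 15 = A 15 \<Longrightarrow> watched S \<iota> wl A'"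
  unfolding watched_def by simp

lemma queued_cong:
  "queued \<iota> qs A q \<Longrightarrow> A' 5 = A 5 \<Longrightarrow> A' 6 = A 6 \<Longrightarrow> queued \<iota> qs A' q"
  unfolding queued_def by simp

lemma stacked_cong:
  "stacked S \<iota> st A \<Longrightarrow> A' 9 = A 9 \<Longrightarrow> A' 10 = A 10 \<Longrightarrow> stacked S \<iota> st A'"
  unfolding stacked_def by simp

text \<open>\<open>m\<close> is only an upper bound on the numbers in use. Numbers are tied to input
  positions, so \<open>m\<close> grows with every symbol, including those that intern
  nothing.\<close>

lemma interned_mono:
  assumes "interned S \<iota> m A" "m \<le> m'"
  shows "interned S \<iota> m' A"
proof -
  interpret interned S \<iota> m A by fact
  show ?thesis
  proof
    show "\<iota> u < m'" if "u \<in> S" for u using less[OF that] assms(2) by simp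
    show "A k a b = 0" if "k \<in> {3, 4}" "m' \<le> a \<or> m' \<le> b" for k a b
      using join_fresh that assms(2) by auto
    show "A k a 0 = 0" if "k \<in> {7, 8}" "m' \<le> a" for k a
      using bit_fresh that assms(2) by auto
  qed (fact inj empty top bot join_subterms prefix join_entry bit_entry operands)+
qed

lemma put_apply [simp]:
  "k' \<noteq> k \<Longrightarrow> put k a b v A k' = A k'"
  "put k a b v A k a' b' = (if a' = a \<and> b' = b then v else A k a' b')"
  by (auto simp: put_def)

lemma join_eq_iff:
  "k \<in> {3, 4} \<Longrightarrow> k' \<in> {3, 4} \<Longrightarrow> join k x y = join k' x' y' \<longleftrightarrow> k = k' \<and> x = x' \<and> y = y'"
  by (auto simp: join_def)

lemma join_neq [simp]:
  "join k x y \<noteq> Atom a" "join k x y \<noteq> Top" "join k x y \<noteq> Bot"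
  "Atom a \<noteq> join k x y" "Top \<noteq> join k x y" "Bot \<noteq> join k x y"
  by (auto simp: join_def)

lemma size_join: "size x < size (join k x y)" "size y < size (join k x y)"
  by (auto simp: join_def)

lemma join_irrefl [simp]: "join k x y \<noteq> x" "join k x y \<noteq> y" "x \<noteq> join k x y" "y \<noteq> join k x y"
  using size_join[of x k y] size_join(2)[of y k x] by (metis less_irrefl)+

lemma (in interned) subterm_closed: "subterm_closed S"
proof -
  have "join 3 u v = Conj u v" "join 4 u v = Imp u v" for u v :: term_infon by (simp_all add: join_def)
  then show ?thesis unfolding subterm_closed_def by (metis join_subterms)
qed

lemma (in interned) inj_iff: "u \<in> S \<Longrightarrow> v \<in> S \<Longrightarrow> \<iota> u = \<iota> v \<longleftrightarrow> u = v"
  using inj_onD[OF inj] by blast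

lemma (in interned) inj_on_insert: "z \<notin> S \<Longrightarrow> inj_on (\<iota>(z := m)) (insert z S)"
  using inj less by (force simp: inj_on_def)

text \<open>Row and column \<open>m\<close> of both tables are still blank by
  \<open>join_fresh\<close>. This is correct after the insertion, because no interned compound has
  the new infon as an operand.\<close>

lemma (in interned) insert_join:
  assumes k: "k \<in> {3, 4}" and xy: "x \<in> S" "y \<in> S" and notin: "join k x y \<notin> S"
    and tab: "A' k = (put k (\<iota> x) (\<iota> y) m A) k"
    and other: "\<And>l. l \<in> {3, 4, 7, 8} \<Longrightarrow> l \<noteq> k \<Longrightarrow> A' l = A l"
    and arg: "A' 11 = put 11 m 0 (\<iota> x) A 11" "A' 12 = put 12 m 0 (\<iota> y) A 12"
      "A' 13 = put 13 m 0 k A 13"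
  shows "interned (insert (join k x y) S) (\<iota>(join k x y := m)) (Suc m) A'"
proof -
  define z where "z = join k x y"
  define \<iota>' where "\<iota>' = \<iota>(z := m)"
  have old: "\<iota>' u = \<iota> u" "u \<noteq> z" if "u \<in> S" for u
    using that notin by (auto simp: \<iota>'_def z_def)
  have new: "\<iota>' z = m" by (simp add: \<iota>'_def)
  \<comment> \<open>Operands lie in the old set \<open>S\<close> and not merely in the extended one:
    the new infon is an operand of nothing, itself included.\<close>
  have sub: "u \<in> S \<and> v \<in> S" if "join l u v \<in> insert z S" for l u v
  proof (cases "join l u v = z")
    case True
    then show ?thesis using xy by (auto simp: z_def join_def split: if_splits)
  next
    case False
    then show ?thesis using that join_subterms by blast
  qed
  have atom: "Atom cs \<in> insert z S \<longleftrightarrow> Atom cs \<in> S" for cs by (auto simp: z_def)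
  have "interned (insert z S) \<iota>' (Suc m) A'"
  proof
    show "inj_on \<iota>' (insert z S)" unfolding \<iota>'_def z_def by (rule inj_on_insert[OF notin])
    show "\<iota>' u < Suc m" if "u \<in> insert z S" for u
      using that less old new by (cases "u = z") (auto simp: less_Suc_eq)
    show "Atom [] \<in> insert z S" "Top \<in> insert z S" "Bot \<in> insert z S"
      "\<iota>' (Atom []) = 0" "\<iota>' Top = 1" "\<iota>' Bot = 2"
      using empty top bot old by simp_all
    show "u \<in> insert z S \<and> v \<in> insert z S" if "join l u v \<in> insert z S" for l u v
      using sub[OF that] by simp
    show "Atom bs \<in> insert z S" if "Atom (bs @ [b]) \<in> insert z S" for bs b
      using that prefix atom by blast
    show "A' l (\<iota>' u) (\<iota>' v) = (if join l u v \<in> insert z S then \<iota>' (join l u v) else 0)"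
      if l: "l \<in> {3, 4}" and uv: "u \<in> insert z S" "v \<in> insert z S" for l u v
    proof (cases "u \<in> S \<and> v \<in> S")
      case True
      have "A' l (\<iota> u) (\<iota> v) = (if l = k \<and> u = x \<and> v = y then m else A l (\<iota> u) (\<iota> v))"
        using tab other[of l] l inj_iff True xy by (cases "l = k") auto
      moreover have "join l u v = z \<longleftrightarrow> l = k \<and> u = x \<and> v = y"
        unfolding z_def using join_eq_iff l k by blast
      ultimately show ?thesis using join_entry[OF l] True old new by auto
    next
      case False
      then have m: "\<iota>' u = m \<or> \<iota>' v = m" using uv new by auto
      moreover have "m \<noteq> \<iota> x" "m \<noteq> \<iota> y" using less xy by (auto dest: less_imp_neq)
      ultimately have "A' l (\<iota>' u) (\<iota>' v) = A l (\<iota>' u) (\<iota>' v)"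
        using tab other[of l] l by (cases "l = k") auto
      also have "\<dots> = 0" by (rule join_fresh[OF l]) (use m in auto)
      finally show ?thesis using False sub[of l u v] by auto
    qed
    show "A' l a b = 0" if l: "l \<in> {3, 4}" and ab: "Suc m \<le> a \<or> Suc m \<le> b" for l a b
    proof -
      have "\<not> (a = \<iota> x \<and> b = \<iota> y)" using ab less[OF xy(1)] less[OF xy(2)] by auto
      then have "A' l a b = A l a b" using tab other[of l] l by (cases "l = k") auto
      then show ?thesis using join_fresh[OF l, of a b] ab by auto
    qed
    have bits: "A' l = A l" if "l \<in> {7, 8}" for l
      using that k by (intro other) auto
    show "A' l (\<iota>' (Atom bs)) 0 =
        (if Atom (bs @ [l = 8]) \<in> insert z S then \<iota>' (Atom (bs @ [l = 8])) else 0)"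
      if "l \<in> {7, 8}" "Atom bs \<in> insert z S" for l bs
      using that bits bit_entry old atom by auto
    show "A' l a 0 = 0" if "l \<in> {7, 8}" "Suc m \<le> a" for l a
      using bit_fresh[of l a] bits that by auto
    show "A' 11 (\<iota>' (join l u v)) 0 = \<iota>' u \<and> A' 12 (\<iota>' (join l u v)) 0 = \<iota>' v \<and>
        A' 13 (\<iota>' (join l u v)) 0 = l" if l: "l \<in> {3, 4}" and in': "join l u v \<in> insert z S" for l u v
    proof (cases "join l u v = z")
      case True
      then have "l = k" "u = x" "v = y" using k l by (auto simp: z_def join_eq_iff)
      then show ?thesis using True new arg old xy by simp
    next
      case False
      then have "join l u v \<in> S" using in' by simp
      then show ?thesis using sub[OF in'] arg old operands[OF l] less[of "join l u v"] by simp
    qed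
  qed
  then show ?thesis by (simp add: z_def \<iota>'_def)
qed

text \<open>The new atom is a new leaf of the trie: prefix closure of \<open>S\<close> excludes
  interned extensions of it, in accordance with its blank entries in arrays 7 and 8.\<close>

lemma (in interned) insert_Atom:
  assumes k: "k \<in> {7, 8}" and x: "Atom bs \<in> S" and notin: "Atom (bs @ [k = 8]) \<notin> S"
    and A': "A' = put k (\<iota> (Atom bs)) 0 m A"
  shows "interned (insert (Atom (bs @ [k = 8])) S) (\<iota>(Atom (bs @ [k = 8]) := m)) (Suc m) A'"
proof -
  define z where "z = (Atom (bs @ [k = 8]) :: term_infon)"
  define \<iota>' where "\<iota>' = \<iota>(z := m)"
  have old: "\<iota>' u = \<iota> u" "u \<noteq> z" if "u \<in> S" for u
    using that notin by (auto simp: \<iota>'_def z_def)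
  have new: "\<iota>' z = m" by (simp add: \<iota>'_def)
  have join: "join l u v \<in> insert z S \<longleftrightarrow> join l u v \<in> S" for l u v by (auto simp: z_def)
  have same: "A' l = A l" if "l \<notin> {7, 8}" for l using that k by (auto simp: A')
  have atom: "Atom cs \<in> S" if "Atom (cs @ [b]) \<in> insert z S" for cs b
    using that prefix x by (auto simp: z_def)
  have "interned (insert z S) \<iota>' (Suc m) A'"
  proof
    show "inj_on \<iota>' (insert z S)" unfolding \<iota>'_def z_def by (rule inj_on_insert[OF notin])
    show "\<iota>' u < Suc m" if "u \<in> insert z S" for u
      using that less old new by (cases "u = z") (auto simp: less_Suc_eq)
    show "Atom [] \<in> insert z S" "Top \<in> insert z S" "Bot \<in> insert z S"
      "\<iota>' (Atom []) = 0" "\<iota>' Top = 1" "\<iota>' Bot = 2"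
      using empty top bot old by simp_all
    show "u \<in> insert z S \<and> v \<in> insert z S" if "join l u v \<in> insert z S" for l u v
      using join_subterms that join by blast
    show "Atom cs \<in> insert z S" if "Atom (cs @ [b]) \<in> insert z S" for cs b
      using atom[OF that] by simp
    show "A' l (\<iota>' u) (\<iota>' v) = (if join l u v \<in> insert z S then \<iota>' (join l u v) else 0)"
      if l: "l \<in> {3, 4}" and uv: "u \<in> insert z S" "v \<in> insert z S" for l u v
    proof (cases "u \<in> S \<and> v \<in> S")
      case True
      then show ?thesis using join_entry[OF l] old same[of l] l join by auto
    next
      case False
      then have "\<iota>' u = m \<or> \<iota>' v = m" using uv new by auto
      then have "A' l (\<iota>' u) (\<iota>' v) = 0" using join_fresh[OF l] same[of l] l by auto
      then show ?thesis using False join_subterms[of l u v] join by auto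
    qed
    show "A' l a b = 0" if l: "l \<in> {3, 4}" and "Suc m \<le> a \<or> Suc m \<le> b" for l a b
      using that join_fresh[of l a b] same[of l] by auto
    show "A' l (\<iota>' (Atom cs)) 0 =
        (if Atom (cs @ [l = 8]) \<in> insert z S then \<iota>' (Atom (cs @ [l = 8])) else 0)"
      if l: "l \<in> {7, 8}" and cs: "Atom cs \<in> insert z S" for l cs
    proof (cases "Atom cs \<in> S")
      case True
      have *: "Atom (cs @ [l = 8]) = z \<longleftrightarrow> cs = bs \<and> l = k" using k l by (auto simp: z_def)
      have "A' l (\<iota> (Atom cs)) 0 = (if cs = bs \<and> l = k then m else A l (\<iota> (Atom cs)) 0)"
        using inj_iff[OF True x] by (cases "l = k") (auto simp: A')
      then show ?thesis using * bit_entry[OF l True] old new True by auto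
    next
      case False
      then have "\<iota>' (Atom cs) = m" using cs new by auto
      moreover have "m \<noteq> \<iota> (Atom bs)" using less[OF x] by auto
      ultimately have "A' l (\<iota>' (Atom cs)) 0 = A l m 0" by (cases "l = k") (auto simp: A')
      then show ?thesis using False atom bit_fresh[OF l] by auto
    qed
    show "A' l a 0 = 0" if "l \<in> {7, 8}" "Suc m \<le> a" for l a
      using that bit_fresh[of l a] less[OF x] by (cases "l = k") (auto simp: A')
    show "A' 11 (\<iota>' (join l u v)) 0 = \<iota>' u \<and> A' 12 (\<iota>' (join l u v)) 0 = \<iota>' v \<and>
        A' 13 (\<iota>' (join l u v)) 0 = l" if "l \<in> {3, 4}" "join l u v \<in> insert z S" for l u v
      using that join same operands[OF that(1)] old join_subterms[of l u v] by auto
  qed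
  then show ?thesis by (simp add: z_def \<iota>'_def)
qed

text \<open>
  Register 0 holds the length of the input, 1 the position in it, 2 the number of the infon read
  last, 3 the height of the stack, 4 the number of queued infons, and 5 and 6 the current pair of
  the second phase. An infon that is interned when reading position \<open>i\<close> gets the number
  \<open>i + 3\<close>, since 0, 1 and 2 are the empty atom, \<open>Top\<close> and \<open>Bot\<close>; the numbers of
  the latter two are their symbol codes.
\<close>

definition mark_code :: "operand \<Rightarrow> com" where
  "mark_code a =
     Get 11 5 a (Lit 0) ;;
     Cond (Eq (Reg 11) (Lit 0))
       (Put 5 a (Lit 0) (Lit 1) ;; Put 6 (Reg 4) (Lit 0) a ;; Plus 4 (Reg 4) (Lit 1))
       Skip"

definition watch_code :: "operand \<Rightarrow> operand \<Rightarrow> com" where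
  "watch_code a c =
     Get 11 14 a (Lit 0) ;; Put 15 a (Reg 11) c ;; Plus 11 (Reg 11) (Lit 1) ;;
     Put 14 a (Lit 0) (Reg 11)"

definition join_code :: "nat \<Rightarrow> com" where
  "join_code k =
     Get 10 k (Reg 8) (Reg 2) ;;
     Cond (Eq (Reg 10) (Lit 0))
       (Plus 10 (Reg 1) (Lit 3) ;; Put k (Reg 8) (Reg 2) (Reg 10) ;;
        Put 11 (Reg 10) (Lit 0) (Reg 8) ;; Put 12 (Reg 10) (Lit 0) (Reg 2) ;;
        Put 13 (Reg 10) (Lit 0) (Lit k) ;;
        watch_code (Reg 8) (Reg 10) ;; watch_code (Reg 2) (Reg 10) ;;
        watch_code (Lit 2) (Reg 10) ;; watch_code (Reg 10) (Reg 10))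
       Skip ;;
     Set 2 (Reg 10)"

definition bit_code :: "nat \<Rightarrow> com" where
  "bit_code k =
     Get 10 k (Reg 2) (Lit 0) ;;
     Cond (Eq (Reg 10) (Lit 0))
       (Plus 10 (Reg 1) (Lit 3) ;; Put k (Reg 2) (Lit 0) (Reg 10))
       Skip ;;
     Set 2 (Reg 10)"

section \<open>Queue and watch lists under updates\<close>

definition enqueue :: "'a \<Rightarrow> 'a list \<Rightarrow> 'a list" where
  "enqueue x qs = (if x \<in> set qs then qs else qs @ [x])"

lemma set_enqueue [simp]: "set (enqueue x qs) = insert x (set qs)"
  by (auto simp: enqueue_def)

lemma distinct_enqueue [simp]: "distinct (enqueue x qs) = distinct qs"
  by (simp add: enqueue_def)

lemma queued_snoc:
  assumes "queued \<iota> qs A q" "A' = put 6 q 0 (\<iota> x) (put 5 (\<iota> x) 0 1 A)"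
  shows "queued \<iota> (qs @ [x]) A' (q + 1)"
  using assms by (auto simp: queued_def nth_append less_Suc_eq)

text \<open>The bound \<open>4 * m\<close> is preserved because interning a compound adds four watch
  entries while \<open>m\<close> rises by one.\<close>

definition store ::
  "term_infon set \<Rightarrow> (term_infon \<Rightarrow> nat) \<Rightarrow> (term_infon \<Rightarrow> term_infon list) \<Rightarrow> term_infon list \<Rightarrow>
     nat \<Rightarrow> arrays \<Rightarrow> nat \<Rightarrow> bool" where
  "store S \<iota> wl qs m A q \<longleftrightarrow>
     interned S \<iota> m A \<and> watched S \<iota> wl A \<and> watch_complete S wl \<and>
     (\<Sum>u\<in>S. length (wl u)) \<le> 4 * m \<and> queued \<iota> qs A q \<and> distinct qs \<and> set qs \<subseteq> S"

lemma (in interned) finite: "finite S"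
proof (rule finite_imageD[OF _ inj])
  show "finite (\<iota> ` S)" by (rule finite_subset[of _ "{..<m}"]) (use less in auto)
qed

lemma (in interned) card_le: "card S \<le> m"
  using card_mono[of "{..<m}" "\<iota> ` S"] less card_image[OF inj] by auto

definition add_watch :: "'a \<Rightarrow> 'b \<Rightarrow> ('a \<Rightarrow> 'b list) \<Rightarrow> 'a \<Rightarrow> 'b list" where
  "add_watch u z wl = wl(u := wl u @ [z])"

lemma length_add_watch: "length (add_watch u z wl v) = length (wl v) + (if v = u then 1 else 0)"
  by (simp add: add_watch_def)

lemma set_add_watch: "set (add_watch u z wl v) = set (wl v) \<union> (if v = u then {z} else {})"
  by (auto simp: add_watch_def)

lemma sum_add_watch:
  "finite S \<Longrightarrow> u \<in> S \<Longrightarrow>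
    (\<Sum>v\<in>S. length (add_watch u z wl v)) = (\<Sum>v\<in>S. length (wl v)) + 1"
  by (simp add: length_add_watch sum.distrib)

lemma watched_insert:
  assumes w: "watched S \<iota> wl A" and int: "interned S \<iota> m A" and z: "z \<notin> S"
    and A': "A' 14 = A 14" "A' 15 = A 15"
  shows "watched (insert z S) (\<iota>(z := m)) (wl(z := [])) A'"
proof -
  interpret interned S \<iota> m A by fact
  have "m \<notin> \<iota> ` S" using less by (auto dest: less_imp_neq)
  then have "A 14 m 0 = 0" using w by (simp add: watched_def)
  \<comment> \<open>Old lists do not mention the new infon, so changing its number keeps their
    entries correct.\<close>
  moreover have "wl u ! j \<noteq> z" if "u \<in> S" "j < length (wl u)" for u j
  proof -
    have "wl u ! j \<in> S" using w that nth_mem[OF that(2)] unfolding watched_def by blast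
    then show ?thesis using z by blast
  qed
  moreover have "u \<noteq> z" if "u \<in> S" for u using z that by blast
  ultimately show ?thesis using w z unfolding watched_def A' by auto
qed

lemma watched_add_watch:
  assumes w: "watched S \<iota> wl A" and inj: "inj_on \<iota> S" and uz: "u \<in> S" "z \<in> S"
    and z: "\<exists>k\<in>{3, 4}. \<exists>x y. z = join k x y"
    and A': "A' 14 = put 14 (\<iota> u) 0 (length (wl u) + 1) A 14"
      "A' 15 = put 15 (\<iota> u) (length (wl u)) (\<iota> z) A 15"
  shows "watched S \<iota> (add_watch u z wl) A'"
proof -
  have eq: "\<iota> v = \<iota> u \<longleftrightarrow> v = u" if "v \<in> S" for v using inj_onD[OF inj] that uz by blast
  have "A' 14 (\<iota> v) 0 = length (add_watch u z wl v) \<and>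
      (\<forall>j<length (add_watch u z wl v). A' 15 (\<iota> v) j = \<iota> (add_watch u z wl v ! j)) \<and>
      set (add_watch u z wl v) \<subseteq> {z \<in> S. \<exists>k\<in>{3, 4}. \<exists>x y. z = join k x y}" if v: "v \<in> S" for v
  proof (cases "v = u")
    case True
    have "A 15 (\<iota> u) j = \<iota> (wl u ! j)" if "j < length (wl u)" for j
      using w uz that by (simp add: watched_def)
    moreover have "set (wl u) \<subseteq> {z \<in> S. \<exists>k\<in>{3, 4}. \<exists>x y. z = join k x y}"
      using w uz unfolding watched_def by blast
    ultimately show ?thesis using True uz(2) z
      by (auto simp: A' add_watch_def nth_append less_Suc_eq)
  next
    case False
    then show ?thesis using w v eq[OF v] by (simp add: watched_def A' add_watch_def)
  qed
  moreover have "A' 14 a 0 = 0" if "a \<notin> \<iota> ` S" for a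
    using w that uz by (auto simp: watched_def A')
  ultimately show ?thesis unfolding watched_def by blast
qed

section \<open>Correctness of marking, watching and interning\<close>

context ram
begin

text \<open>\<open>Q\<close> is arbitrary and \<open>post\<close> lists what the code guarantees, so
  that the lemma can be applied as a rule underneath the remaining commands. Register 11 is
  overwritten before the argument is used; hence \<open>a \<noteq> Reg 11\<close>.\<close>

lemma wpc_mark:
  assumes inj: "inj_on \<iota> S" and x: "x \<in> S" "set qs \<subseteq> S" and a: "val R a = \<iota> x" "lit_ok a"
    "a \<noteq> Reg 11" and q: "queued \<iota> qs A (R 4)" "length qs + 1 < N"
    and post: "\<And>R' A'. (\<And>r. r \<noteq> 11 \<Longrightarrow> r \<noteq> 4 \<Longrightarrow> R' r = R r) \<Longrightarrow>
      queued \<iota> (enqueue x qs) A' (R' 4) \<Longrightarrow> (\<And>k. k \<noteq> 5 \<Longrightarrow> k \<noteq> 6 \<Longrightarrow> A' k = A k) \<Longrightarrow> Q R' A'"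
  shows "wpc (mark_code a) R A Q"
proof -
  let ?R = "R(11 := A 5 (\<iota> x) 0)"
  have val: "val ?R a = \<iota> x" using a by (cases a) auto
  have "\<iota> x \<in> \<iota> ` set qs \<longleftrightarrow> x \<in> set qs" using inj x by (auto dest: inj_onD)
  then have A5: "A 5 (\<iota> x) 0 = (if x \<in> set qs then 1 else 0)" using q by (simp add: queued_def)
  show ?thesis
  proof (cases "x \<in> set qs")
    case True
    then have "Q ?R A" using q by (intro post) (auto simp: enqueue_def)
    then show ?thesis using True a A5 by (simp add: mark_code_def)
  next
    case False
    let ?A = "put 6 (R 4) 0 (\<iota> x) (put 5 (\<iota> x) 0 1 A)"
    have "Q (?R(4 := R 4 + 1)) ?A"
    proof (rule post)
      show "queued \<iota> (enqueue x qs) ?A ((?R(4 := R 4 + 1)) 4)"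
        using queued_snoc[OF q(1) refl] False by (simp add: enqueue_def)
    qed auto
    then show ?thesis using False a A5 q val
      by (simp add: mark_code_def queued_def)
  qed
qed

lemma wpc_watch:
  assumes w: "watched S \<iota> wl A" and inj: "inj_on \<iota> S" and uz: "u \<in> S" "z \<in> S"
    and z: "\<exists>k\<in>{3, 4}. \<exists>x y. z = join k x y"
    and a: "val R a = \<iota> u" "lit_ok a" "a \<noteq> Reg 11" and c: "val R c = \<iota> z" "lit_ok c" "c \<noteq> Reg 11"
    and len: "length (wl u) + 1 < N"
    and post: "\<And>R' A'. (\<And>r. r \<noteq> 11 \<Longrightarrow> R' r = R r) \<Longrightarrow> watched S \<iota> (add_watch u z wl) A' \<Longrightarrow>
      (\<And>k. k \<noteq> 14 \<Longrightarrow> k \<noteq> 15 \<Longrightarrow> A' k = A k) \<Longrightarrow> Q R' A'"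
  shows "wpc (watch_code a c) R A Q"
proof -
  have val: "val (R(11 := v)) a = \<iota> u" "val (R(11 := v)) c = \<iota> z" for v
    using a c by (cases a; cases c; auto)+
  let ?A = "put 14 (\<iota> u) 0 (length (wl u) + 1) (put 15 (\<iota> u) (length (wl u)) (\<iota> z) A)"
  have "Q (R(11 := length (wl u) + 1)) ?A"
  proof (rule post)
    show "watched S \<iota> (add_watch u z wl) ?A"
      by (rule watched_add_watch[OF w inj uz z]) (simp_all add: put_def)
  qed auto
  moreover have "A 14 (\<iota> u) 0 = length (wl u)" using w uz by (simp add: watched_def)
  ultimately show ?thesis using a c len val by (simp add: watch_code_def)
qed

lemma wpc_join:
  assumes store: "store S \<iota> wl qs m A (R 4)" and k: "k \<in> {3, 4}" and xy: "x \<in> S" "y \<in> S"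
    and R: "R 8 = \<iota> x" "R 2 = \<iota> y" "R 1 + 3 = m" and m: "4 * m + 4 < N"
    and post: "\<And>R' A' S' \<iota>' wl'. (\<And>r. r \<notin> {2, 10, 11} \<Longrightarrow> R' r = R r) \<Longrightarrow>
      store S' \<iota>' wl' qs (Suc m) A' (R' 4) \<Longrightarrow> S \<subseteq> S' \<Longrightarrow> (\<And>u. u \<in> S \<Longrightarrow> \<iota>' u = \<iota> u) \<Longrightarrow>
      join k x y \<in> S' \<Longrightarrow> R' 2 = \<iota>' (join k x y) \<Longrightarrow> A' 9 = A 9 \<Longrightarrow> A' 10 = A 10 \<Longrightarrow> Q R' A'"
  shows "wpc (join_code k) R A Q"
proof -
  from store have int: "interned S \<iota> m A" and w: "watched S \<iota> wl A" and cmp: "watch_complete S wl"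
    and sum: "(\<Sum>u\<in>S. length (wl u)) \<le> 4 * m" and q: "queued \<iota> qs A (R 4)" "distinct qs" "set qs \<subseteq> S"
    by (simp_all add: store_def)
  interpret interned S \<iota> m A by fact
  let ?z = "join k x y"
  have k16: "k < 16" using k by auto
  show ?thesis
  proof (cases "?z \<in> S")
    case True
    \<comment> \<open>The code reads 0 as a missing entry, so an interned compound must have a
      nonzero number; 0 belongs to the empty atom.\<close>
    have "?z \<noteq> Atom []" by simp
    then have nz: "\<iota> ?z \<noteq> 0" using inj_iff[OF True empty(1)] empty(2) by simp
    have "Q (R(10 := \<iota> ?z, 2 := \<iota> ?z)) A"
    proof (rule post[of _ S \<iota> wl])
      show "store S \<iota> wl qs (Suc m) A ((R(10 := \<iota> ?z, 2 := \<iota> ?z)) 4)"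
        using store interned_mono[OF int, of "Suc m"] by (simp add: store_def)
    qed (use True in auto)
    then show ?thesis using True nz R k16 join_entry[OF k xy] by (simp add: join_code_def)
  next
    case False
    define S' where "S' = insert ?z S"
    define \<iota>' where "\<iota>' = \<iota>(?z := m)"
    define wl0 where "wl0 = wl(?z := [])"
    define A0 where
      "A0 = put 13 m 0 k (put 12 m 0 (\<iota> y) (put 11 m 0 (\<iota> x) (put k (\<iota> x) (\<iota> y) m A)))"
    have int': "interned S' \<iota>' (Suc m) A0"
      unfolding S'_def \<iota>'_def
      by (rule insert_join[OF k xy False]) (use k in \<open>auto simp: A0_def put_def\<close>)
    have A0: "A0 l = A l" if "l \<notin> {3, 4, 11, 12, 13}" for l
      using that k by (auto simp: A0_def)
    have w': "watched S' \<iota>' wl0 A0"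
      unfolding S'_def \<iota>'_def wl0_def by (rule watched_insert[OF w int False]) (simp_all add: A0)
    have old: "\<iota>' u = \<iota> u" "u \<noteq> ?z" "wl0 u = wl u" if "u \<in> S" for u
      using that False by (auto simp: \<iota>'_def wl0_def)
    have z': "\<iota>' ?z = m" "?z \<in> S'" "wl0 ?z = []" by (simp_all add: \<iota>'_def S'_def wl0_def)
    have isj: "\<exists>k\<in>{3, 4}. \<exists>u v. ?z = join k u v" using k by blast
    have inS: "x \<in> S'" "y \<in> S'" "Bot \<in> S'" using xy bot by (auto simp: S'_def)
    define wl1 where "wl1 = add_watch x ?z wl0"
    define wl2 where "wl2 = add_watch y ?z wl1"
    define wl3 where "wl3 = add_watch Bot ?z wl2"
    define wl4 where "wl4 = add_watch ?z ?z wl3"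
    have fin: "finite S'" using finite by (simp add: S'_def)
    have sum0: "(\<Sum>u\<in>S'. length (wl0 u)) \<le> 4 * m"
    proof -
      have "(\<Sum>u\<in>S'. length (wl0 u)) = (\<Sum>u\<in>S. length (wl u))"
        using False finite old z' by (simp add: S'_def)
      then show ?thesis using sum by simp
    qed
    \<comment> \<open>The four entries are counted with multiplicity: when operands coincide or one
      is \<open>Bot\<close>, a list receives the same compound more than once.\<close>
    have sums: "(\<Sum>u\<in>S'. length (wl1 u)) \<le> 4 * m + 1" "(\<Sum>u\<in>S'. length (wl2 u)) \<le> 4 * m + 2"
      "(\<Sum>u\<in>S'. length (wl3 u)) \<le> 4 * m + 3" "(\<Sum>u\<in>S'. length (wl4 u)) \<le> 4 * m + 4"
      using sum0 fin inS z' by (simp_all add: wl1_def wl2_def wl3_def wl4_def sum_add_watch)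
    \<comment> \<open>No list is longer than the sum of all lengths. Before the fourth entry the sum
      is at most \<open>4 * m + 3\<close>, so the incremented length is still below
      \<open>N\<close>.\<close>
    have len: "length (f u) + 1 < N" if "(\<Sum>u\<in>S'. length (f u)) \<le> 4 * m + 3" "u \<in> S'"
      for f :: "term_infon \<Rightarrow> term_infon list" and u
      using member_le_sum[OF that(2) _ fin, of "\<lambda>u. length (f u)"] that(1) m by simp
    have q': "queued \<iota>' qs A' r" if "queued \<iota> qs A r" "A' 5 = A 5" "A' 6 = A 6" for A' r
    proof -
      have "\<iota>' ` set qs = \<iota> ` set qs" using old q by (auto intro!: image_cong)
      moreover have "\<iota>' (qs ! i) = \<iota> (qs ! i)" if "i < length qs" for i
        using old(1) q that nth_mem by blast
      ultimately show ?thesis using that by (simp add: queued_def)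
    qed
    have complete: "watch_complete S' wl4"
      unfolding watch_complete_def
    proof (intro ballI allI impI)
      fix l u v t assume l: "l \<in> {3, 4 :: nat}" and in': "join l u v \<in> S'"
        and t: "t \<in> {u, v, Bot, join l u v}"
      show "join l u v \<in> set (wl4 t)"
      proof (cases "join l u v = ?z")
        case True
        then have "l = k" "u = x" "v = y" using join_eq_iff[OF l k] by auto
        then show ?thesis using t by (auto simp: wl1_def wl2_def wl3_def wl4_def set_add_watch)
      next
        case False
        then have *: "join l u v \<in> S" using in' by (simp add: S'_def)
        then have "join l u v \<in> set (wl t)" using cmp l t unfolding watch_complete_def by blast
        moreover have "t \<in> S" using t * join_subterms bot by blast
        ultimately have "join l u v \<in> set (wl0 t)" using old by simp
        then show ?thesis by (simp add: wl1_def wl2_def wl3_def wl4_def set_add_watch)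
      qed
    qed
    have inj': "inj_on \<iota>' S'" using int' by (rule interned.inj)
    let ?R = "R(10 := m)"
    have vals: "\<iota>' x = \<iota> x" "\<iota>' y = \<iota> y" "\<iota>' Bot = 2" using old xy bot by auto
    let ?w4 = "watch_code (Reg 10) (Reg 10)"
    let ?w3 = "watch_code (Lit 2) (Reg 10)"
    let ?w2 = "watch_code (Reg 2) (Reg 10)"
    let ?w1 = "watch_code (Reg 8) (Reg 10)"
    have "wpc (?w1 ;; ?w2 ;; ?w3 ;; ?w4) ?R A0 (\<lambda>R' A'. Q (R'(2 := R' 10)) A')"
      unfolding wpc.simps
    proof (rule wpc_watch[OF w' inj' inS(1) z'(2) isj])
      fix R1 A1 assume R1: "\<And>r. r \<noteq> 11 \<Longrightarrow> R1 r = ?R r" and w1: "watched S' \<iota>' (add_watch x ?z wl0) A1"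
        and A1: "\<And>k. k \<noteq> 14 \<Longrightarrow> k \<noteq> 15 \<Longrightarrow> A1 k = A0 k"
      show "wpc ?w2 R1 A1 (\<lambda>R A. wpc ?w3 R A (\<lambda>R A. wpc ?w4 R A (\<lambda>R A. Q (R(2 := R 10)) A)))"
      proof (rule wpc_watch[OF w1[folded wl1_def] inj' inS(2) z'(2) isj])
        fix R2 A2 assume R2: "\<And>r. r \<noteq> 11 \<Longrightarrow> R2 r = R1 r"
          and w2: "watched S' \<iota>' (add_watch y ?z wl1) A2"
          and A2: "\<And>k. k \<noteq> 14 \<Longrightarrow> k \<noteq> 15 \<Longrightarrow> A2 k = A1 k"
        show "wpc ?w3 R2 A2 (\<lambda>R A. wpc ?w4 R A (\<lambda>R A. Q (R(2 := R 10)) A))"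
        proof (rule wpc_watch[OF w2[folded wl2_def] inj' inS(3) z'(2) isj])
          fix R3 A3 assume R3: "\<And>r. r \<noteq> 11 \<Longrightarrow> R3 r = R2 r"
            and w3: "watched S' \<iota>' (add_watch Bot ?z wl2) A3"
            and A3: "\<And>k. k \<noteq> 14 \<Longrightarrow> k \<noteq> 15 \<Longrightarrow> A3 k = A2 k"
          show "wpc ?w4 R3 A3 (\<lambda>R A. Q (R(2 := R 10)) A)"
          proof (rule wpc_watch[OF w3[folded wl3_def] inj' z'(2) z'(2) isj])
            fix R4 A4 assume R4: "\<And>r. r \<noteq> 11 \<Longrightarrow> R4 r = R3 r"
              and w4: "watched S' \<iota>' (add_watch ?z ?z wl3) A4"
              and A4: "\<And>k. k \<noteq> 14 \<Longrightarrow> k \<noteq> 15 \<Longrightarrow> A4 k = A3 k"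
            have R': "R4 r = ?R r" if "r \<noteq> 11" for r using R1 R2 R3 R4 that by simp
            have A': "A4 l = A0 l" if "l \<noteq> 14" "l \<noteq> 15" for l using A1 A2 A3 A4 that by simp
            show "Q (R4(2 := R4 10)) A4"
            proof (rule post[of _ S' \<iota>' wl4])
              have "interned S' \<iota>' (Suc m) A4" by (rule interned_cong[OF int']) (auto intro: A')
              moreover have "queued \<iota>' qs A4 (R 4)"
                using q' q A' A0 by simp
              ultimately show "store S' \<iota>' wl4 qs (Suc m) A4 ((R4(2 := R4 10)) 4)"
                using w4 complete sums q R' by (auto simp: store_def wl4_def S'_def)
            qed (use R' A' A0 old z' in \<open>auto simp: S'_def\<close>)
          qed (use R1 R2 R3 z' len sums in auto)
        qed (use R1 R2 vals z' inS len sums in auto)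
      qed (use R1 R vals z' inS len sums in auto)
    qed (use R vals z' inS len sum0 in auto)
    then show ?thesis using False R k16 m join_entry[OF k xy]
      by (simp add: join_code_def A0_def)
  qed
qed

lemma wpc_bit:
  assumes store: "store S \<iota> wl qs m A (R 4)" and k: "k \<in> {7, 8}" and x: "Atom bs \<in> S"
    and R: "R 2 = \<iota> (Atom bs)" "R 1 + 3 = m" and m: "m < N"
    and post: "\<And>R' A' S' \<iota>' wl'. (\<And>r. r \<notin> {2, 10, 11} \<Longrightarrow> R' r = R r) \<Longrightarrow>
      store S' \<iota>' wl' qs (Suc m) A' (R' 4) \<Longrightarrow> S \<subseteq> S' \<Longrightarrow> (\<And>u. u \<in> S \<Longrightarrow> \<iota>' u = \<iota> u) \<Longrightarrow>
      Atom (bs @ [k = 8]) \<in> S' \<Longrightarrow> R' 2 = \<iota>' (Atom (bs @ [k = 8])) \<Longrightarrow>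
      A' 9 = A 9 \<Longrightarrow> A' 10 = A 10 \<Longrightarrow> Q R' A'"
  shows "wpc (bit_code k) R A Q"
proof -
  from store have int: "interned S \<iota> m A" and w: "watched S \<iota> wl A" and cmp: "watch_complete S wl"
    and sum: "(\<Sum>u\<in>S. length (wl u)) \<le> 4 * m" and q: "queued \<iota> qs A (R 4)" "distinct qs" "set qs \<subseteq> S"
    by (simp_all add: store_def)
  interpret interned S \<iota> m A by fact
  let ?z = "Atom (bs @ [k = 8]) :: term_infon"
  have k16: "k < 16" using k by auto
  show ?thesis
  proof (cases "?z \<in> S")
    case True
    have "?z \<noteq> Atom []" by simp
    then have nz: "\<iota> ?z \<noteq> 0" using inj_iff[OF True empty(1)] empty(2) by simp
    have "Q (R(10 := \<iota> ?z, 2 := \<iota> ?z)) A"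
    proof (rule post[of _ S \<iota> wl])
      show "store S \<iota> wl qs (Suc m) A ((R(10 := \<iota> ?z, 2 := \<iota> ?z)) 4)"
        using store interned_mono[OF int, of "Suc m"] by (simp add: store_def)
    qed (use True in auto)
    then show ?thesis using True nz R k16 bit_entry[OF k x] by (simp add: bit_code_def)
  next
    case False
    define S' where "S' = insert ?z S"
    define \<iota>' where "\<iota>' = \<iota>(?z := m)"
    define A0 where "A0 = put k (\<iota> (Atom bs)) 0 m A"
    have int': "interned S' \<iota>' (Suc m) A0"
      unfolding S'_def \<iota>'_def by (rule insert_Atom[OF k x False]) (simp add: A0_def)
    have A0: "A0 l = A l" if "l \<notin> {7, 8}" for l
      using that k by (auto simp: A0_def)
    have "watched S' \<iota>' (wl(?z := [])) A0"
      unfolding S'_def \<iota>'_def by (rule watched_insert[OF w int False]) (simp_all add: A0)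
    moreover have old: "\<iota>' u = \<iota> u" "u \<noteq> ?z" if "u \<in> S" for u
      using that False by (auto simp: \<iota>'_def)
    have "watch_complete S' (wl(?z := []))"
      unfolding watch_complete_def
    proof (intro ballI allI impI)
      fix l u v t assume l: "l \<in> {3, 4 :: nat}" and in': "join l u v \<in> S'"
        and t: "t \<in> {u, v, Bot, join l u v}"
      have *: "join l u v \<in> S" using in' by (simp add: S'_def)
      then have "join l u v \<in> set (wl t)" using cmp l t unfolding watch_complete_def by blast
      moreover have "t \<in> S" using t * join_subterms bot by blast
      ultimately show "join l u v \<in> set ((wl(?z := [])) t)" using old by simp
    qed
    moreover have "(\<Sum>u\<in>S'. length ((wl(?z := [])) u)) \<le> 4 * Suc m"
    proof -
      have "(\<Sum>u\<in>S'. length ((wl(?z := [])) u)) = (\<Sum>u\<in>S. length (wl u))"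
        using False finite old(2) by (simp add: S'_def)
      then show ?thesis using sum by simp
    qed
    moreover have "queued \<iota>' qs A0 (R 4)"
    proof -
      have "\<iota>' ` set qs = \<iota> ` set qs" using old q by (auto intro!: image_cong)
      moreover have "\<iota>' (qs ! i) = \<iota> (qs ! i)" if "i < length qs" for i
        using old(1) q that nth_mem by blast
      ultimately show ?thesis using q A0 by (simp add: queued_def)
    qed
    ultimately have st: "store S' \<iota>' (wl(?z := [])) qs (Suc m) A0 (R 4)"
      using int' q by (auto simp: store_def S'_def)
    have "Q (R(10 := m, 2 := m)) A0"
      by (rule post[of _ S' \<iota>' "wl(?z := [])"])
        (use st old A0 in \<open>auto simp: S'_def \<iota>'_def\<close>)
    then show ?thesis using False R k16 m bit_entry[OF k x]
      by (simp add: bit_code_def A0_def)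
  qed
qed

end

section \<open>Reading the input and saturation\<close>

definition read_code :: com where
  "read_code =
     Inp 7 (Reg 1) ;;
     Cond (Lt (Reg 7) (Lit 3)) (Set 2 (Reg 7))
      (Cond (Lt (Reg 7) (Lit 5))
        (Put 9 (Reg 3) (Lit 0) (Reg 2) ;; Put 10 (Reg 3) (Lit 0) (Reg 7) ;;
         Plus 3 (Reg 3) (Lit 1) ;; Set 2 (Lit 0))
      (Cond (Eq (Reg 7) (Lit 6))
        (Minus 3 (Reg 3) (Lit 1) ;; Get 8 9 (Reg 3) (Lit 0) ;; Get 12 10 (Reg 3) (Lit 0) ;;
         Cond (Eq (Reg 12) (Lit 3)) (join_code 3) (join_code 4))
      (Cond (Eq (Reg 7) (Lit 7)) (bit_code 7)
      (Cond (Eq (Reg 7) (Lit 8)) (bit_code 8)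
      (Cond (Eq (Reg 7) (Lit 9)) (mark_code (Reg 2) ;; Set 2 (Lit 0))
       Skip))))) ;;
     Plus 1 (Reg 1) (Lit 1)"

text \<open>Reading the four marks once is enough, because each branch closes the compound in a
  single pass. If the conclusion of an implication is derived, only the implication can be missing;
  elimination matters only in the other case.\<close>

definition close_code :: com where
  "close_code =
     Get 8 11 (Reg 10) (Lit 0) ;; Get 9 12 (Reg 10) (Lit 0) ;; Get 12 13 (Reg 10) (Lit 0) ;;
     Get 13 5 (Reg 10) (Lit 0) ;; Get 14 5 (Reg 8) (Lit 0) ;; Get 15 5 (Reg 9) (Lit 0) ;;
     Get 16 5 (Lit 2) (Lit 0) ;;
     Cond (Eq (Reg 12) (Lit 3))
       (Cond (Eq (Reg 13) (Lit 1)) (mark_code (Reg 8) ;; mark_code (Reg 9))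
         (Cond (Eq (Reg 14) (Lit 1)) (Cond (Eq (Reg 15) (Lit 1)) (mark_code (Reg 10)) Skip) Skip))
       (Cond (Eq (Reg 15) (Lit 1)) (mark_code (Reg 10))
         (Cond (Eq (Reg 13) (Lit 1))
           (Cond (Eq (Reg 14) (Lit 1)) (mark_code (Reg 9))
             (Cond (Eq (Reg 16) (Lit 1)) (mark_code (Reg 9)) Skip))
           Skip))"

text \<open>The nested traversal of the queue and the watch lists is flattened: one execution
  handles one watch entry or moves to the next queued infon. The loop body is thus loop-free, and a
  single number serves as variant.\<close>

definition step_code :: com where
  "step_code =
     Get 8 6 (Reg 5) (Lit 0) ;; Get 9 14 (Reg 8) (Lit 0) ;;
     Cond (Lt (Reg 6) (Reg 9))
       (Get 10 15 (Reg 8) (Reg 6) ;; Plus 6 (Reg 6) (Lit 1) ;; close_code)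
       (Plus 5 (Reg 5) (Lit 1) ;; Set 6 (Lit 0))"

lemma stacked_mono:
  assumes "stacked S \<iota> st A" "S \<subseteq> S'" "\<And>u. u \<in> S \<Longrightarrow> \<iota>' u = \<iota> u" "A' 9 = A 9" "A' 10 = A 10"
  shows "stacked S' \<iota>' st A'"
proof -
  have "fst (rev st ! i) \<in> S" if "i < length st" for i
  proof -
    have "rev st ! i \<in> set st" using that by (metis length_rev nth_mem set_rev)
    then show ?thesis using assms(1) by (auto simp: stacked_def)
  qed
  then show ?thesis using assms unfolding stacked_def by auto
qed

lemma stacked_push:
  assumes "stacked S \<iota> st A" "x \<in> S" "k \<in> {3, 4}"
  shows "stacked S \<iota> ((x, k) # st)
    (put 10 (length st) 0 k (put 9 (length st) 0 (\<iota> x) A))"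
  using assms by (auto simp: stacked_def nth_append less_Suc_eq)

lemma stacked_pop:
  assumes "stacked S \<iota> ((x, k) # st) A"
  shows "stacked S \<iota> st A" "x \<in> S" "k \<in> {3, 4}" "A 9 (length st) 0 = \<iota> x" "A 10 (length st) 0 = k"
  using assms by (auto simp: stacked_def nth_append less_Suc_eq)

lemma closed_at_join:
  "k \<in> {3, 4} \<Longrightarrow> closed_at M (join k x y) \<longleftrightarrow>
     (if k = 3 then join k x y \<in> M \<longleftrightarrow> x \<in> M \<and> y \<in> M
      else (y \<in> M \<longrightarrow> join k x y \<in> M) \<and> (join k x y \<in> M \<and> (x \<in> M \<or> Bot \<in> M) \<longrightarrow> y \<in> M))"
  by (auto simp: join_def)

lemma derives_rules:
  "\<Gamma> \<turnstile> x \<Longrightarrow> \<Gamma> \<turnstile> y \<Longrightarrow> \<Gamma> \<turnstile> join 3 x y"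
  "\<Gamma> \<turnstile> join 3 x y \<Longrightarrow> \<Gamma> \<turnstile> x"
  "\<Gamma> \<turnstile> join 3 x y \<Longrightarrow> \<Gamma> \<turnstile> y"
  "\<Gamma> \<turnstile> y \<Longrightarrow> \<Gamma> \<turnstile> join 4 x y"
  "\<Gamma> \<turnstile> x \<Longrightarrow> \<Gamma> \<turnstile> join 4 x y \<Longrightarrow> \<Gamma> \<turnstile> y"
  "\<Gamma> \<turnstile> Bot \<Longrightarrow> \<Gamma> \<turnstile> join 4 x y \<Longrightarrow> \<Gamma> \<turnstile> y"
proof -
  have j: "join 3 x y = Conj x y" "join 4 x y = Imp x y" by (simp_all add: join_def)
  show "\<Gamma> \<turnstile> x \<Longrightarrow> \<Gamma> \<turnstile> y \<Longrightarrow> \<Gamma> \<turnstile> join 3 x y"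
    unfolding j by (rule derives_step, rule conj_intro) auto
  show "\<Gamma> \<turnstile> join 3 x y \<Longrightarrow> \<Gamma> \<turnstile> x"
    unfolding j by (rule derives_step, rule conj_elim1[of _ y]) auto
  show "\<Gamma> \<turnstile> join 3 x y \<Longrightarrow> \<Gamma> \<turnstile> y"
    unfolding j by (rule derives_step, rule conj_elim2[of x]) auto
  show "\<Gamma> \<turnstile> y \<Longrightarrow> \<Gamma> \<turnstile> join 4 x y"
    unfolding j by (rule derives_step, rule imp_intro) auto
  show "\<Gamma> \<turnstile> x \<Longrightarrow> \<Gamma> \<turnstile> join 4 x y \<Longrightarrow> \<Gamma> \<turnstile> y"
    unfolding j by (rule derives_step, rule imp_elim[of x]) auto
  show "\<Gamma> \<turnstile> Bot \<Longrightarrow> \<Gamma> \<turnstile> join 4 x y \<Longrightarrow> \<Gamma> \<turnstile> y"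
    unfolding j by (rule derives_step, rule weak_bot[of _ x]) auto
qed

text \<open>
  The second phase runs through the pairs of a queued infon and an entry of its watch list.
  An infon is pending if one of the pairs from the current pair \<open>(h, j)\<close> on leads to it.
\<close>

definition pending :: "('a \<Rightarrow> 'b list) \<Rightarrow> 'a list \<Rightarrow> nat \<Rightarrow> nat \<Rightarrow> 'b \<Rightarrow> bool" where
  "pending wl qs h j z \<longleftrightarrow>
     (\<exists>i l. i < length qs \<and> l < length (wl (qs ! i)) \<and> wl (qs ! i) ! l = z \<and> (h < i \<or> h = i \<and> j \<le> l))"

lemma pending_next_head:
  assumes "pending wl qs h j z" "length (wl (qs ! h)) \<le> j"
  shows "pending wl qs (h + 1) 0 z"
proof -
  obtain i l where *: "i < length qs" "l < length (wl (qs ! i))" "wl (qs ! i) ! l = z"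
    "h < i \<or> h = i \<and> j \<le> l" using assms unfolding pending_def by blast
  then have "h + 1 < i \<or> h + 1 = i \<and> 0 \<le> l" using assms by auto
  then show ?thesis using * unfolding pending_def by blast
qed

lemma pending_next:
  assumes "pending wl qs h j z"
  shows "z = wl (qs ! h) ! j \<or> pending wl (qs @ ys) h (j + 1) z"
proof -
  obtain i l where *: "i < length qs" "l < length (wl (qs ! i))" "wl (qs ! i) ! l = z"
    "h < i \<or> h = i \<and> j \<le> l" using assms unfolding pending_def by blast
  show ?thesis
  proof (cases "h = i \<and> j = l")
    case False
    then have "h < i \<or> h = i \<and> j + 1 \<le> l" using * by auto
    moreover have "(qs @ ys) ! i = qs ! i" "i < length (qs @ ys)" using * by (auto simp: nth_append)
    ultimately have "pending wl (qs @ ys) h (j + 1) z" using * unfolding pending_def by metis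
    then show ?thesis ..
  qed (use * in auto)
qed

lemma pending_appended:
  assumes "u \<in> set ys" "z \<in> set (wl u)" "h < length qs"
  shows "pending wl (qs @ ys) h j z"
proof -
  obtain i where i: "i < length ys" "ys ! i = u" using assms(1) by (metis in_set_conv_nth)
  obtain l where l: "l < length (wl u)" "wl u ! l = z" using assms(2) by (metis in_set_conv_nth)
  show ?thesis unfolding pending_def
    by (rule exI[of _ "length qs + i"], rule exI[of _ l]) (use i l assms(3) in simp)
qed

text \<open>If no infon watched by \<open>z\<close> occurs among the new ones \<open>ys\<close>, its
  closure condition is unaffected. Otherwise \<open>z\<close> stands in the watch list of a member
  of \<open>ys\<close>, which lies behind the head \<open>h\<close> and will still be
  visited.\<close>

lemma closed_or_pending:
  assumes "closed_at (set qs) z" "z \<in> S" "watch_complete S wl" "h < length qs"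
  shows "closed_at (set (qs @ ys)) z \<or> pending wl (qs @ ys) h j z"
proof (cases "\<exists>k\<in>{3, 4}. \<exists>x y. z = join k x y")
  case True
  then obtain k x y where z: "z = join k x y" "k \<in> {3, 4}" by blast
  show ?thesis
  proof (cases "\<exists>u\<in>{x, y, Bot, z}. u \<in> set ys")
    case True
    then show ?thesis using pending_appended assms z unfolding watch_complete_def by metis
  next
    case False
    then have "closed_at (set (qs @ ys)) z" using assms(1) z by (auto simp: closed_at_join split: if_splits)
    then show ?thesis ..
  qed
next
  case False
  then have "closed_at (set (qs @ ys)) z" by (cases z) (auto simp: join_def)
  then show ?thesis ..
qed

text \<open>The counting argument for linear time: the queue has no repetitions, so each watch list
  is traversed at most once. The summand 1 pays for the move to the next queued infon.\<close>

lemma watch_sum_bound: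
  fixes wl :: "'a \<Rightarrow> 'b list"
  assumes "finite S" "distinct qs" "set qs \<subseteq> S"
    and "h < length qs \<and> j \<le> length (wl (qs ! h)) \<or> h = length qs \<and> j = 0"
  shows "(\<Sum>i<h. length (wl (qs ! i)) + 1) + j \<le> (\<Sum>u\<in>S. length (wl u) + 1)"
proof -
  let ?f = "\<lambda>u. length (wl u) + 1"
  have "(\<Sum>i<h. ?f (qs ! i)) + j \<le> (\<Sum>i<length qs. ?f (qs ! i))"
  proof (cases "h < length qs")
    case True
    then have "(\<Sum>i<h. ?f (qs ! i)) + j \<le> (\<Sum>i<Suc h. ?f (qs ! i))" using assms(4) by simp
    also have "\<dots> \<le> (\<Sum>i<length qs. ?f (qs ! i))"
      by (rule sum_mono2) (use True in auto)
    finally show ?thesis .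
  qed (use assms(4) in auto)
  also have "\<dots> = (\<Sum>u\<in>set qs. ?f u)"
    using sum.distinct_set_conv_list[OF assms(2), of ?f]
    by (simp add: sum_list_sum_nth atLeast0LessThan del: One_nat_def)
  also have "\<dots> \<le> (\<Sum>u\<in>S. ?f u)" by (rule sum_mono2) (use assms in auto)
  finally show ?thesis .
qed

section \<open>Loop invariants of the two phases\<close>

context ram
begin

text \<open>The next free number is the position plus 3, for the three infons interned in advance. A
  symbol pushes at most one entry, which gives \<open>R 3 \<le> R 1\<close> and keeps the stack
  height below \<open>N\<close>. \<open>Top\<close> is queued from the start because it is an
  axiom.\<close>

definition reading :: "parse_state \<Rightarrow> regfile \<Rightarrow> arrays \<Rightarrow> bool" where
  "reading = (\<lambda>(x, st, hs) R A. \<exists>S \<iota> wl qs.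
     store S \<iota> wl qs (R 1 + 3) A (R 4) \<and> stacked S \<iota> st A \<and> length st = R 3 \<and> R 3 \<le> R 1 \<and>
     x \<in> S \<and> R 2 = \<iota> x \<and> set qs = insert Top (set hs) \<and>
     R 0 = n \<and> R 1 \<le> n \<and> R 5 = 0 \<and> R 6 = 0)"

lemma read_step:
  assumes reading: "reading p R A" and i: "R 1 < n" and N: "4 * n + 16 \<le> N"
    and inp: "0 < inp (R 1)" and p': "parse_step (inp (R 1)) p = Some p'"
  shows "wpc read_code R A (\<lambda>R' A'. reading p' R' A' \<and> R' 1 = R 1 + 1)"
proof -
  obtain x st hs where p: "p = (x, st, hs)" by (cases p)
  obtain S \<iota> wl qs where inv: "store S \<iota> wl qs (R 1 + 3) A (R 4)" "stacked S \<iota> st A"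
    "length st = R 3" "R 3 \<le> R 1" "x \<in> S" "R 2 = \<iota> x" "set qs = insert Top (set hs)"
    "R 0 = n" "R 5 = 0" "R 6 = 0"
    using reading unfolding p reading_def by auto
  let ?m = "R 1 + 3"
  let ?s = "inp (R 1)"
  let ?R = "R(7 := ?s)"
  interpret interned S \<iota> ?m A using inv(1) by (simp add: store_def)
  have q: "distinct qs" "set qs \<subseteq> S" "queued \<iota> qs A (R 4)" using inv(1) by (simp_all add: store_def)
  have len: "length qs + 1 < N"
    using card_mono[OF finite q(2)] distinct_card[OF q(1)] card_le N i by simp
  have st: "store S \<iota> wl qs (Suc ?m) A (R 4)"
    using inv(1) interned_mono[of S \<iota> ?m A "Suc ?m"] by (simp add: store_def)
  have le: "R 1 + 1 < N" using N i by simp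
  let ?Q = "\<lambda>R' A'. R' 1 + 1 < N \<and> reading p' (R'(1 := R' 1 + 1)) A' \<and> R' 1 = R 1"
  \<comment> \<open>Each kind of symbol now only has to exhibit its store and parse state; the final
    increment of the position is accounted for here.\<close>
  have fin: "?Q R' A'"
    if "\<And>r. r \<in> {0, 1, 5, 6} \<Longrightarrow> R' r = R r" "store S' \<iota>' wl' qs' (Suc ?m) A' (R' 4)"
      "p' = (x', st', hs')" "stacked S' \<iota>' st' A'" "length st' = R' 3" "R' 3 \<le> R 1 + 1"
      "x' \<in> S'" "R' 2 = \<iota>' x'" "set qs' = insert Top (set hs')"
    for R' A' S' \<iota>' wl' qs' x' st' hs'
  proof -
    have "store S' \<iota>' wl' qs' ((R'(1 := R' 1 + 1)) 1 + 3) A' ((R'(1 := R' 1 + 1)) 4)"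
      using that(1)[of 1] that(2) by simp
    then have "reading p' (R'(1 := R' 1 + 1)) A'"
      unfolding reading_def that(3) prod.case
      using that inv i by (intro exI[of _ S'] exI[of _ \<iota>'] exI[of _ wl'] exI[of _ qs']) simp
    then show ?thesis using that(1)[of 1] le by simp
  qed
  have body: "wpc (Cond (Lt (Reg 7) (Lit 3)) (Set 2 (Reg 7))
      (Cond (Lt (Reg 7) (Lit 5))
        (Put 9 (Reg 3) (Lit 0) (Reg 2) ;; Put 10 (Reg 3) (Lit 0) (Reg 7) ;;
         Plus 3 (Reg 3) (Lit 1) ;; Set 2 (Lit 0))
      (Cond (Eq (Reg 7) (Lit 6))
        (Minus 3 (Reg 3) (Lit 1) ;; Get 8 9 (Reg 3) (Lit 0) ;; Get 12 10 (Reg 3) (Lit 0) ;;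
         Cond (Eq (Reg 12) (Lit 3)) (join_code 3) (join_code 4))
      (Cond (Eq (Reg 7) (Lit 7)) (bit_code 7)
      (Cond (Eq (Reg 7) (Lit 8)) (bit_code 8)
      (Cond (Eq (Reg 7) (Lit 9)) (mark_code (Reg 2) ;; Set 2 (Lit 0))
       Skip)))))) ?R A ?Q" (is "wpc ?c _ _ _")
  proof -
    consider "?s < 3" | "?s = 3 \<or> ?s = 4" | "?s = 6" | "?s = 7 \<or> ?s = 8" | "?s = 9"
      | "?s = 5 \<or> ?s > 9" by linarith
    then show ?thesis
    proof cases
      case 1
      then have s: "?s = 1 \<or> ?s = 2" using inp by linarith
      let ?x = "if ?s = 1 then Top else Bot"
      have "?Q (?R(2 := ?s)) A"
        by (rule fin[of _ S \<iota> wl qs _ ?x st hs]) (use st inv p' s top bot p in auto)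
      then show ?thesis using 1 by simp
    next
      case 2
      let ?A = "put 10 (length st) 0 ?s (put 9 (length st) 0 (\<iota> x) A)"
      have stA: "store S \<iota> wl qs (Suc ?m) ?A (R 4)"
        using st unfolding store_def
        by (auto intro: interned_cong watched_cong queued_cong)
      have "stacked S \<iota> ((x, ?s) # st) ?A"
        by (rule stacked_push[OF inv(2)]) (use 2 inv in auto)
      then have "?Q (?R(3 := R 3 + 1, 2 := 0)) ?A"
        by (intro fin[of _ S \<iota> wl qs _ "Atom []" "(x, ?s) # st" hs])
          (use stA inv p' 2 empty p in auto)
      then show ?thesis using 2 inv le by (auto simp: fun_upd_twist)
    next
      case 3
      then obtain y k st' where st': "st = (y, k) # st'" "p' = (join k y x, st', hs)"
        using p' by (auto simp: p split: list.splits)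
      note pop = stacked_pop[OF inv(2)[unfolded st'(1)]]
      let ?R' = "?R(3 := R 3 - 1, 8 := \<iota> y, 12 := k)"
      have d: "R 3 - 1 = length st'" using inv st' by simp
      have "wpc (join_code k) ?R' A ?Q"
      proof (rule wpc_join[OF _ pop(3) pop(2) inv(5)])
        fix R' A' S' \<iota>' wl'
        assume *: "\<And>r. r \<notin> {2, 10, 11} \<Longrightarrow> R' r = ?R' r" "store S' \<iota>' wl' qs (Suc ?m) A' (R' 4)"
          "S \<subseteq> S'" "\<And>u. u \<in> S \<Longrightarrow> \<iota>' u = \<iota> u" "join k y x \<in> S'" "R' 2 = \<iota>' (join k y x)"
          "A' 9 = A 9" "A' 10 = A 10"
        have "stacked S' \<iota>' st' A'" by (rule stacked_mono[OF pop(1) *(3) *(4) *(7,8)])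
        then show "?Q R' A'"
          by (intro fin[of _ S' \<iota>' wl' qs _ "join k y x" st' hs]) (use * inv d st' in auto)
      qed (use inv N i in auto)
      then show ?thesis using 3 pop d by (auto split: if_splits)
    next
      case 4
      then obtain bs where bs: "x = Atom bs" "p' = (Atom (bs @ [?s = 8]), st, hs)"
        using p' by (auto simp: p split: infon.splits)
      have s: "?s \<in> {7, 8}" using 4 by auto
      have "wpc (bit_code ?s) ?R A ?Q"
      proof (rule wpc_bit[OF _ s, of S \<iota> wl qs ?m _ _ bs])
        fix R' A' S' \<iota>' wl'
        assume *: "\<And>r. r \<notin> {2, 10, 11} \<Longrightarrow> R' r = ?R r" "store S' \<iota>' wl' qs (Suc ?m) A' (R' 4)"
          "S \<subseteq> S'" "\<And>u. u \<in> S \<Longrightarrow> \<iota>' u = \<iota> u" "Atom (bs @ [?s = 8]) \<in> S'"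
          "R' 2 = \<iota>' (Atom (bs @ [?s = 8]))" "A' 9 = A 9" "A' 10 = A 10"
        have "stacked S' \<iota>' st A'" by (rule stacked_mono[OF inv(2) *(3) *(4) *(7,8)])
        then show "?Q R' A'"
          by (intro fin[of _ S' \<iota>' wl' qs _ "Atom (bs @ [?s = 8])" st hs]) (use * bs inv in auto)
      qed (use inv N i bs in auto)
      then show ?thesis using 4 by auto
    next
      case 5
      have "wpc (mark_code (Reg 2)) ?R A (\<lambda>R' A'. ?Q (R'(2 := 0)) A')"
      proof (rule wpc_mark[OF inj inv(5) q(2)])
        fix R' A'
        assume *: "\<And>r. r \<noteq> 11 \<Longrightarrow> r \<noteq> 4 \<Longrightarrow> R' r = ?R r" "queued \<iota> (enqueue x qs) A' (R' 4)"
          "\<And>k. k \<noteq> 5 \<Longrightarrow> k \<noteq> 6 \<Longrightarrow> A' k = A k"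
        have "interned S \<iota> (Suc ?m) A'" "watched S \<iota> wl A'"
          using st * unfolding store_def by (auto intro: interned_cong watched_cong)
        then have "store S \<iota> wl (enqueue x qs) (Suc ?m) A' (R' 4)"
          using st *(2) inv(5) unfolding store_def by auto
        moreover have "stacked S \<iota> st A'" by (rule stacked_cong[OF inv(2)]) (simp_all add: *)
        ultimately show "?Q (R'(2 := 0)) A'"
          by (intro fin[of _ S \<iota> wl "enqueue x qs" _ "Atom []" st "x # hs"])
            (use * inv p' 5 empty p in auto)
      qed (use inv q len in auto)
      then show ?thesis using 5 by simp
    next
      case 6
      have "?Q ?R A"
        by (rule fin[of _ S \<iota> wl qs _ x st hs]) (use st inv p' 6 p in auto)
      then show ?thesis using 6 by auto
    qed
  qed
  define c where "c = ?c"
  have "wpc c ?R A (\<lambda>R' A'. wpc (Plus 1 (Reg 1) (Lit 1)) R' A'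
      (\<lambda>R' A'. reading p' R' A' \<and> R' 1 = R 1 + 1))"
    by (rule wpc_mono[OF body[folded c_def]]) auto
  then have "wpc (Inp 7 (Reg 1) ;; c ;; Plus 1 (Reg 1) (Lit 1)) R A
      (\<lambda>R' A'. reading p' R' A' \<and> R' 1 = R 1 + 1)"
    using i by (simp only: wpc.simps(7,8) val.simps lit_ok.simps simp_thms)
  then show ?thesis by (simp only: read_code_def c_def)
qed

text \<open>New infons are only appended to the queue, as \<open>pending_next\<close> and
  \<open>closed_or_pending\<close> require.\<close>

lemma wpc_close:
  assumes int: "interned S \<iota> m A" and q: "queued \<iota> qs A (R 4)" "distinct qs" "set qs \<subseteq> S"
    and k: "k \<in> {3, 4}" and z: "join k x y \<in> S" and R: "R 10 = \<iota> (join k x y)"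
    and m: "m + 1 < N" and sound: "\<forall>u\<in>set qs. \<Gamma> \<turnstile> u"
    and post: "\<And>R' A' ys. (\<And>r. r \<in> {0, 1, 2, 3, 5, 6} \<Longrightarrow> R' r = R r) \<Longrightarrow>
      (\<And>k. k \<noteq> 5 \<Longrightarrow> k \<noteq> 6 \<Longrightarrow> A' k = A k) \<Longrightarrow> queued \<iota> (qs @ ys) A' (R' 4) \<Longrightarrow>
      distinct (qs @ ys) \<Longrightarrow> set (qs @ ys) \<subseteq> S \<Longrightarrow> \<forall>u\<in>set (qs @ ys). \<Gamma> \<turnstile> u \<Longrightarrow>
      closed_at (set (qs @ ys)) (join k x y) \<Longrightarrow> Q R' A'"
  shows "wpc close_code R A Q"
proof -
  interpret interned S \<iota> m A by fact
  let ?z = "join k x y"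
  have xy: "x \<in> S" "y \<in> S" using join_subterms z by blast+
  have len: "length vs + 1 < N" if "distinct vs" "set vs \<subseteq> S" for vs
    using card_mono[OF finite that(2)] distinct_card[OF that(1)] card_le m by simp
  have A5: "A 5 (\<iota> u) 0 = (if u \<in> set qs then 1 else 0)" if "u \<in> S" for u
  proof -
    have "\<iota> u \<in> \<iota> ` set qs \<longleftrightarrow> u \<in> set qs" using inj that q by (auto dest: inj_onD)
    then show ?thesis using q by (simp add: queued_def)
  qed
  let ?b = "\<lambda>u. if u \<in> set qs then 1 else (0::nat)"
  define R0 where
    "R0 = R(8 := \<iota> x, 9 := \<iota> y, 12 := k, 13 := ?b ?z, 14 := ?b x, 15 := ?b y, 16 := ?b Bot)"
  have R0: "R0 8 = \<iota> x" "R0 9 = \<iota> y" "R0 10 = R 10" "R0 4 = R 4"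
    "r \<in> {0, 1, 2, 3, 5, 6} \<Longrightarrow> R0 r = R r" for r
    by (auto simp: R0_def)
  have mark: "wpc (mark_code a) R1 A1 Q'"
    if "queued \<iota> vs A1 (R1 4)" "distinct vs" "set vs \<subseteq> S" "u \<in> S" "val R1 a = \<iota> u" "lit_ok a" "a \<noteq> Reg 11"
      "\<And>R' A'. (\<And>r. r \<noteq> 11 \<Longrightarrow> r \<noteq> 4 \<Longrightarrow> R' r = R1 r) \<Longrightarrow> (\<And>k. k \<noteq> 5 \<Longrightarrow> k \<noteq> 6 \<Longrightarrow> A' k = A1 k) \<Longrightarrow>
        queued \<iota> (enqueue u vs) A' (R' 4) \<Longrightarrow> Q' R' A'"
    for a R1 A1 vs u Q'
    by (rule wpc_mark[OF inj that(4,3,5,6,7,1) len[OF that(2,3)]]) (rule that(8))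
  have enq: "\<exists>ys. enqueue u vs = vs @ ys" for u :: term_infon and vs by (simp add: enqueue_def)
  have finish: "Q R' A'"
    if "\<And>r. r \<in> {0, 1, 2, 3, 5, 6} \<Longrightarrow> R' r = R r" "\<And>k. k \<noteq> 5 \<Longrightarrow> k \<noteq> 6 \<Longrightarrow> A' k = A k"
      "queued \<iota> vs A' (R' 4)" "\<exists>ys. vs = qs @ ys" "distinct vs" "set vs \<subseteq> S" "\<forall>u\<in>set vs. \<Gamma> \<turnstile> u"
      "closed_at (set vs) ?z" for R' A' vs
    using that post by blast
  have mark1: "wpc (mark_code a) R0 A Q"
    if "val R0 a = \<iota> u" "lit_ok a" "a \<noteq> Reg 11" "u \<in> S" "\<Gamma> \<turnstile> u" "closed_at (insert u (set qs)) ?z"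
    for a u
  proof (rule mark[OF _ q(2,3) that(4,1,2,3)])
    fix R' A'
    assume *: "\<And>r. r \<noteq> 11 \<Longrightarrow> r \<noteq> 4 \<Longrightarrow> R' r = R0 r" "\<And>k. k \<noteq> 5 \<Longrightarrow> k \<noteq> 6 \<Longrightarrow> A' k = A k"
      "queued \<iota> (enqueue u qs) A' (R' 4)"
    show "Q R' A'"
      by (rule finish[of _ _ "enqueue u qs"]) (use * R0 q that sound enq in auto)
  qed (use q R0 in simp)
  have skip: "Q R0 A" if "closed_at (set qs) ?z"
    by (rule finish[of _ _ qs]) (use q R0 sound that in auto)
  have j: "\<Gamma> \<turnstile> u" if "u \<in> set qs" for u using sound that by blast
  \<comment> \<open>The decision tree of \<open>close_code\<close> with its register tests replaced
    by membership in the queue; the case split at the end matches the two.\<close>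
  have "if k = 3
    then (if ?z \<in> set qs then wpc (mark_code (Reg 8)) R0 A (\<lambda>R' A'. wpc (mark_code (Reg 9)) R' A' Q)
      else if x \<in> set qs then if y \<in> set qs then wpc (mark_code (Reg 10)) R0 A Q else Q R0 A
      else Q R0 A)
    else (if y \<in> set qs then wpc (mark_code (Reg 10)) R0 A Q
      else if ?z \<in> set qs then if x \<in> set qs then wpc (mark_code (Reg 9)) R0 A Q
        else if Bot \<in> set qs then wpc (mark_code (Reg 9)) R0 A Q else Q R0 A
      else Q R0 A)" (is ?body)
  proof (cases "k = 3")
    case True
    have "wpc (mark_code (Reg 8)) R0 A (\<lambda>R' A'. wpc (mark_code (Reg 9)) R' A' Q)" if "?z \<in> set qs"
    proof (rule mark[of qs _ _ x])
      fix R1 A1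
      assume 1: "\<And>r. r \<noteq> 11 \<Longrightarrow> r \<noteq> 4 \<Longrightarrow> R1 r = R0 r" "\<And>k. k \<noteq> 5 \<Longrightarrow> k \<noteq> 6 \<Longrightarrow> A1 k = A k"
        "queued \<iota> (enqueue x qs) A1 (R1 4)"
      show "wpc (mark_code (Reg 9)) R1 A1 Q"
      proof (rule mark[of "enqueue x qs" _ _ y])
        fix R2 A2
        assume 2: "\<And>r. r \<noteq> 11 \<Longrightarrow> r \<noteq> 4 \<Longrightarrow> R2 r = R1 r" "\<And>k. k \<noteq> 5 \<Longrightarrow> k \<noteq> 6 \<Longrightarrow> A2 k = A1 k"
          "queued \<iota> (enqueue y (enqueue x qs)) A2 (R2 4)"
        show "Q R2 A2"
        proof (rule finish[of _ _ "enqueue y (enqueue x qs)"])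
          show "\<forall>u\<in>set (enqueue y (enqueue x qs)). \<Gamma> \<turnstile> u"
            using sound derives_rules(2,3)[of \<Gamma> x y] j[OF that] True by auto
          show "closed_at (set (enqueue y (enqueue x qs))) ?z"
            using that True by (simp add: closed_at_join)
        qed (use 1 2 R0 q xy in \<open>auto simp: enqueue_def\<close>)
      qed (use 1 R0 q xy in auto)
    qed (use q R0 xy in auto)
    moreover have "wpc (mark_code (Reg 10)) R0 A Q" if "x \<in> set qs" "y \<in> set qs"
      by (rule mark1[of _ ?z]) (use R R0 z that True derives_rules(1)[OF j[OF that(1)] j[OF that(2)]] in \<open>auto simp: closed_at_join\<close>)
    moreover have "Q R0 A" if "?z \<notin> set qs" "x \<notin> set qs \<or> y \<notin> set qs"
      by (rule skip) (use that True in \<open>auto simp: closed_at_join\<close>)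
    ultimately show ?thesis using True by simp
  next
    case False
    then have 4: "k = 4" using k by simp
    have "wpc (mark_code (Reg 10)) R0 A Q" if "y \<in> set qs"
      by (rule mark1[of _ ?z]) (use R R0 z that 4 derives_rules(4)[OF j[OF that]] in \<open>auto simp: closed_at_join\<close>)
    moreover have "wpc (mark_code (Reg 9)) R0 A Q" if "?z \<in> set qs" "x \<in> set qs \<or> Bot \<in> set qs"
    proof (rule mark1[of _ y])
      show "\<Gamma> \<turnstile> y" using that 4 derives_rules(5,6)[of \<Gamma> _ y] j by blast
      show "closed_at (insert y (set qs)) ?z" using that 4 by (simp add: closed_at_join)
    qed (use xy R0 in auto)
    moreover have "Q R0 A"
      if "y \<notin> set qs" "?z \<notin> set qs \<or> x \<notin> set qs \<and> Bot \<notin> set qs"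
      by (rule skip) (use that 4 in \<open>auto simp: closed_at_join\<close>)
    ultimately show ?thesis using 4 by simp
  qed
  then show ?thesis
    using operands[OF k z] R A5[OF z] A5[OF xy(1)] A5[OF xy(2)] A5[OF bot(1)] bot(2) k
    by (cases "k = 3"; cases "?z \<in> set qs"; cases "x \<in> set qs"; cases "y \<in> set qs";
      cases "Bot \<in> set qs"; simp add: close_code_def R0_def)
qed

text \<open>\<open>v\<close> is the number of moves still possible: all watch entries and infons,
  minus the distance already covered. Closed or pending is the invariant that degenerates to closed
  once the queue is exhausted.\<close>

definition saturating ::
  "term_infon set \<Rightarrow> term_infon \<Rightarrow> nat \<Rightarrow> regfile \<Rightarrow> arrays \<Rightarrow> bool" where
  "saturating \<Gamma> \<phi> v R A \<longleftrightarrow>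
     (\<exists>S \<iota> wl qs m. interned S \<iota> m A \<and> watched S \<iota> wl A \<and> watch_complete S wl \<and>
       queued \<iota> qs A (R 4) \<and> distinct qs \<and> set qs \<subseteq> S \<and> m + 1 < N \<and>
       (\<Sum>u\<in>S. length (wl u)) + 1 < N \<and>
       (\<forall>u\<in>set qs. \<Gamma> \<turnstile> u) \<and> insert Top \<Gamma> \<subseteq> set qs \<and>
       (R 5 < length qs \<and> R 6 \<le> length (wl (qs ! R 5)) \<or> R 5 = length qs \<and> R 6 = 0) \<and>
       (\<forall>z\<in>S. closed_at (set qs) z \<or> pending wl qs (R 5) (R 6) z) \<and>
       R 2 = \<iota> \<phi> \<and> \<phi> \<in> S \<and>
       v + ((\<Sum>i<R 5. length (wl (qs ! i)) + 1) + R 6) = (\<Sum>u\<in>S. length (wl u) + 1))"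

lemma saturate_step:
  assumes sat: "saturating \<Gamma> \<phi> v R A" and lt: "R 5 < R 4"
  shows "wpc step_code R A (\<lambda>R' A'. \<exists>v'<v. saturating \<Gamma> \<phi> v' R' A')"
proof -
  obtain S \<iota> wl qs m where inv: "interned S \<iota> m A" "watched S \<iota> wl A" "watch_complete S wl"
    "queued \<iota> qs A (R 4)" "distinct qs" "set qs \<subseteq> S" "m + 1 < N"
    "(\<Sum>u\<in>S. length (wl u)) + 1 < N" "\<forall>u\<in>set qs. \<Gamma> \<turnstile> u" "insert Top \<Gamma> \<subseteq> set qs"
    "R 5 < length qs \<and> R 6 \<le> length (wl (qs ! R 5)) \<or> R 5 = length qs \<and> R 6 = 0"
    "\<forall>z\<in>S. closed_at (set qs) z \<or> pending wl qs (R 5) (R 6) z" "R 2 = \<iota> \<phi>" "\<phi> \<in> S"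
    "v + ((\<Sum>i<R 5. length (wl (qs ! i)) + 1) + R 6) = (\<Sum>u\<in>S. length (wl u) + 1)"
    using sat unfolding saturating_def by (elim exE conjE) (rule that, assumption+)
  interpret interned S \<iota> m A by fact
  let ?u = "qs ! R 5"
  have h: "R 5 < length qs" using lt inv(4) by (simp add: queued_def)
  then have u: "?u \<in> S" using inv(6) nth_mem by blast
  have A6: "A 6 (R 5) 0 = \<iota> ?u" using inv(4) h by (simp add: queued_def)
  have A14: "A 14 (\<iota> ?u) 0 = length (wl ?u)" using inv(2) u by (simp add: watched_def)
  let ?R = "R(8 := \<iota> ?u, 9 := length (wl ?u))"
  \<comment> \<open>Both branches advance the position by exactly one.
    \<open>watch_sum_bound\<close> keeps the new position within the total, so the smaller variant
    exists as a natural number.\<close>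
  have resume: "\<exists>v'<v. saturating \<Gamma> \<phi> v' R' A'"
    if "interned S \<iota> m A'" "watched S \<iota> wl A'" "queued \<iota> qs' A' (R' 4)" "distinct qs'" "set qs' \<subseteq> S"
      "\<forall>u\<in>set qs'. \<Gamma> \<turnstile> u" "insert Top \<Gamma> \<subseteq> set qs'"
      "R' 5 < length qs' \<and> R' 6 \<le> length (wl (qs' ! R' 5)) \<or> R' 5 = length qs' \<and> R' 6 = 0"
      "\<forall>z\<in>S. closed_at (set qs') z \<or> pending wl qs' (R' 5) (R' 6) z" "R' 2 = R 2"
      "(\<Sum>i<R' 5. length (wl (qs' ! i)) + 1) + R' 6 = (\<Sum>i<R 5. length (wl (qs ! i)) + 1) + R 6 + 1"
    for R' A' qs'
  proof -
    have "(\<Sum>i<R' 5. length (wl (qs' ! i)) + 1) + R' 6 \<le> (\<Sum>u\<in>S. length (wl u) + 1)"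
      using watch_sum_bound[where wl = wl, OF finite that(4,5)] that(8) by blast
    then obtain v' where v': "v' + ((\<Sum>i<R' 5. length (wl (qs' ! i)) + 1) + R' 6) =
      (\<Sum>u\<in>S. length (wl u) + 1)" by (metis le_add_diff_inverse2)
    then have "v' < v" using inv(15) that(11) by linarith
    moreover have "saturating \<Gamma> \<phi> v' R' A'"
      unfolding saturating_def
      by (intro exI[of _ S] exI[of _ \<iota>] exI[of _ wl] exI[of _ qs'] exI[of _ m] conjI)
        (use that inv v' in simp_all)
    ultimately show ?thesis by blast
  qed
  show ?thesis
  proof (cases "R 6 < length (wl ?u)")
    case True
    let ?z = "wl ?u ! R 6"
    have A15: "A 15 (\<iota> ?u) (R 6) = \<iota> ?z" using inv(2) u True by (simp add: watched_def)
    have "?z \<in> set (wl ?u)" using True by simp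
    then obtain k x y where z: "?z = join k x y" "k \<in> {3, 4}" "?z \<in> S"
      using inv(2) u unfolding watched_def by blast
    let ?R' = "?R(10 := \<iota> ?z, 6 := R 6 + 1)"
    have "wpc close_code ?R' A (\<lambda>R' A'. \<exists>v'<v. saturating \<Gamma> \<phi> v' R' A')"
    proof (rule wpc_close[OF inv(1) _ inv(5,6) z(2) z(3)[unfolded z(1)] _ inv(7,9)])
      fix R' A' ys
      assume *: "\<And>r. r \<in> {0, 1, 2, 3, 5, 6} \<Longrightarrow> R' r = ?R' r" "\<And>k. k \<noteq> 5 \<Longrightarrow> k \<noteq> 6 \<Longrightarrow> A' k = A k"
        "queued \<iota> (qs @ ys) A' (R' 4)" "distinct (qs @ ys)" "set (qs @ ys) \<subseteq> S"
        "\<forall>u\<in>set (qs @ ys). \<Gamma> \<turnstile> u" "closed_at (set (qs @ ys)) (join k x y)"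
      have R': "R' 5 = R 5" "R' 6 = R 6 + 1" "R' 2 = R 2" using *(1) by simp_all
      have nth: "(qs @ ys) ! i = qs ! i" if "i \<le> R 5" for i using that h by (simp add: nth_append)
      \<comment> \<open>The compound just visited is closed by the call, an earlier closed one stays
        closed or becomes pending through \<open>ys\<close>, and any other pending one lies further
        on.\<close>
      have "closed_at (set (qs @ ys)) t \<or> pending wl (qs @ ys) (R 5) (R 6 + 1) t" if t: "t \<in> S" for t
        using inv(12) t closed_or_pending[OF _ t inv(3) h] pending_next[of wl qs "R 5" "R 6" t ys] *(7) z(1)
        by metis
      then have p: "\<forall>z\<in>S. closed_at (set (qs @ ys)) z \<or> pending wl (qs @ ys) (R' 5) (R' 6) z"
        unfolding R' by blast
      show "\<exists>v'<v. saturating \<Gamma> \<phi> v' R' A'"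
      proof (rule resume[OF _ _ *(3-6) _ _ p R'(3)])
        show "interned S \<iota> m A'" by (rule interned_cong[OF inv(1)]) (auto intro: *(2))
        show "watched S \<iota> wl A'" by (rule watched_cong[OF inv(2)]) (simp_all add: *(2))
        show "insert Top \<Gamma> \<subseteq> set (qs @ ys)" using inv(10) by auto
        show "R' 5 < length (qs @ ys) \<and> R' 6 \<le> length (wl ((qs @ ys) ! R' 5)) \<or>
            R' 5 = length (qs @ ys) \<and> R' 6 = 0"
          using True h nth[of "R 5"] by (simp add: R')
        have "(\<Sum>i<R 5. length (wl ((qs @ ys) ! i)) + 1) = (\<Sum>i<R 5. length (wl (qs ! i)) + 1)"
          by (rule sum.cong) (use nth in auto)
        then show "(\<Sum>i<R' 5. length (wl ((qs @ ys) ! i)) + 1) + R' 6 =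
            (\<Sum>i<R 5. length (wl (qs ! i)) + 1) + R 6 + 1" by (simp add: R')
      qed
    qed (use z inv in auto)
    moreover have "R 6 + 1 < N"
    proof -
      have "length (wl ?u) \<le> (\<Sum>u\<in>S. length (wl u))" by (rule member_le_sum[OF u]) (use finite in auto)
      then show ?thesis using True inv(8) by linarith
    qed
    ultimately show ?thesis using True A6 A14 A15 by (simp add: step_code_def)
  next
    case False
    have R6: "R 6 = length (wl ?u)" using False inv(11) h by auto
    let ?R' = "?R(5 := R 5 + 1, 6 := 0)"
    have "length qs \<le> m"
      using card_mono[OF finite inv(6)] distinct_card[OF inv(5)] card_le by simp
    then have "R 5 + 1 < N" using h inv(7) by linarith
    moreover have "\<exists>v'<v. saturating \<Gamma> \<phi> v' ?R' A"
    proof (rule resume[OF inv(1,2) _ inv(5,6,9,10)])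
      show "\<forall>z\<in>S. closed_at (set qs) z \<or> pending wl qs (?R' 5) (?R' 6) z"
        using inv(12) pending_next_head[of wl qs "R 5" "R 6"] R6 by auto
    qed (use inv(4) h R6 in auto)
    ultimately show ?thesis using False A6 A14 by (simp add: step_code_def)
  qed
qed

text \<open>With the queue exhausted nothing is pending, so the queued set is closed on
  \<open>S\<close>. Locality yields completeness; soundness is part of the invariant.\<close>

lemma saturated:
  assumes "saturating \<Gamma> \<phi> v R A" "\<not> R 5 < R 4"
  shows "A 5 (R 2) 0 = (if \<Gamma> \<turnstile> \<phi> then 1 else 0)"
proof -
  obtain S \<iota> wl qs m where inv: "interned S \<iota> m A"
    "queued \<iota> qs A (R 4)" "set qs \<subseteq> S" "\<forall>u\<in>set qs. \<Gamma> \<turnstile> u" "insert Top \<Gamma> \<subseteq> set qs"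
    "\<forall>z\<in>S. closed_at (set qs) z \<or> pending wl qs (R 5) (R 6) z" "R 2 = \<iota> \<phi>" "\<phi> \<in> S"
    using assms(1) unfolding saturating_def by (elim exE conjE) (rule that, assumption+)
  interpret interned S \<iota> m A by fact
  have "length qs \<le> R 5" using inv(2) assms(2) by (simp add: queued_def)
  then have "\<not> pending wl qs (R 5) (R 6) z" for z unfolding pending_def by auto
  then have "\<forall>z\<in>S. closed_at (set qs) z" using inv by blast
  then have "\<phi> \<in> set qs \<longleftrightarrow> \<Gamma> \<turnstile> \<phi>"
    using derives_in_closed[OF subterm_closed inv(3)] inv by auto
  moreover have "\<iota> \<phi> \<in> \<iota> ` set qs \<longleftrightarrow> \<phi> \<in> set qs" using inj inv by (auto dest: inj_onD)
  ultimately show ?thesis using inv by (simp add: queued_def)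
qed

text \<open>The bound adds \<open>4 * (n + 3)\<close> watch entries and one move for each of at most
  \<open>n + 3\<close> interned infons. A compound none of whose watched infons is queued satisfies
  its closure condition vacuously; any other is pending.\<close>

lemma reading_saturating:
  assumes "reading (\<phi>, [], hs) R A" and N: "4 * n + 16 \<le> N"
  shows "\<exists>v\<le>5 * (n + 3). saturating (set hs) \<phi> v R A"
proof -
  obtain S \<iota> wl qs where inv: "store S \<iota> wl qs (R 1 + 3) A (R 4)"
    "\<phi> \<in> S" "R 2 = \<iota> \<phi>" "set qs = insert Top (set hs)" "R 1 \<le> n" "R 5 = 0" "R 6 = 0"
    using assms(1) unfolding reading_def by auto
  let ?m = "R 1 + 3"
  have st: "interned S \<iota> ?m A" "watched S \<iota> wl A" "watch_complete S wl"
    "(\<Sum>u\<in>S. length (wl u)) \<le> 4 * ?m" "queued \<iota> qs A (R 4)" "distinct qs" "set qs \<subseteq> S"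
    using inv(1) by (simp_all add: store_def)
  interpret interned S \<iota> ?m A by fact
  let ?v = "\<Sum>u\<in>S. length (wl u) + 1"
  have "?v = (\<Sum>u\<in>S. length (wl u)) + card S" by (subst sum.distrib) simp
  also have "\<dots> \<le> 4 * ?m + ?m" by (rule add_mono[OF st(4) card_le])
  also have "\<dots> \<le> 5 * (n + 3)" using inv(5) by simp
  finally have bound: "?v \<le> 5 * (n + 3)" .
  have "closed_at (set qs) z \<or> pending wl qs 0 0 z" if z: "z \<in> S" for z
  proof (cases "\<exists>k\<in>{3, 4}. \<exists>x y. z = join k x y")
    case True
    then obtain k x y where k: "k \<in> {3, 4}" "z = join k x y" by blast
    show ?thesis
    proof (cases "\<exists>u\<in>{x, y, Bot, z}. u \<in> set qs")
      case True
      then obtain u where u: "u \<in> set qs" "u \<in> {x, y, Bot, z}" by blast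
      then have "z \<in> set (wl u)" using st(3) k z unfolding watch_complete_def by blast
      then obtain i l where "i < length qs" "qs ! i = u" "l < length (wl u)" "wl u ! l = z"
        using u(1) by (auto simp: in_set_conv_nth)
      then have "pending wl qs 0 0 z" unfolding pending_def by auto
      then show ?thesis ..
    next
      case False
      then have "closed_at (set qs) z" using k by (auto simp: closed_at_join)
      then show ?thesis ..
    qed
  next
    case False
    then have "closed_at (set qs) z" by (cases z) (auto simp: join_def)
    then show ?thesis ..
  qed
  moreover have "\<forall>u\<in>set qs. set hs \<turnstile> u" using inv(4) by (auto intro: derives_axiom)
  moreover have "qs \<noteq> []" using inv(4) by auto
  ultimately have "saturating (set hs) \<phi> ?v R A"
    unfolding saturating_def
    by (intro exI[of _ S] exI[of _ \<iota>] exI[of _ wl] exI[of _ qs] exI[of _ ?m] conjI)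
      (use st inv N in simp_all)
  then show ?thesis using bound by blast
qed

end

section \<open>The decision program\<close>

definition decision_code :: com where
  "decision_code =
     mark_code (Lit 1) ;;
     While (Lt (Reg 1) (Reg 0)) read_code ;;
     While (Lt (Reg 5) (Reg 4)) step_code ;;
     Get 8 5 (Reg 2) (Lit 0)"

text \<open>Two doublings and the constant 16 put N = 4n + 16 into machine register 1. Machine
  register 6 is register 0 of the structured program, which expects n.\<close>

definition set_up :: "instr list" where
  "set_up = [Add 1 0 0, Add 1 1 1, Const 2 16, Add 1 1 2, Move 6 0]"

text \<open>The start address 5 is the length of \<open>set_up\<close>. Machine register 14 is
  register 8 of the structured program, where the answer is found.\<close>

definition decision_program :: program where
  "decision_program = set_up @ compile 5 decision_code @ [Move 0 14]"

text \<open>Each loop pays 4 per iteration besides its body and 4 on exit; the summand 10 is the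
  final array access.\<close>

definition running_time :: "nat \<Rightarrow> nat" where
  "running_time n =
     cost (mark_code (Lit 1)) + (n * (cost read_code + 4) + 4 +
       (5 * (n + 3) * (cost step_code + 4) + 4 + 10))"

context ram
begin

text \<open>Blank arrays already represent the store that consists of the empty atom,
  \<open>Top\<close> and \<open>Bot\<close>, with no watch entries; only \<open>Top\<close> has to
  be queued.\<close>

lemma reading_initial:
  assumes N: "4 * n + 16 \<le> N"
  shows "wpc (mark_code (Lit 1)) ((\<lambda>_. 0)(0 := n)) (\<lambda>_ _ _. 0)
    (\<lambda>R A. reading (Atom [], [], []) R A \<and> R 1 = 0)"
proof -
  let ?S = "{Atom [], Top, Bot} :: term_infon set"
  let ?\<iota> = "\<lambda>x. if x = Top then 1 else if x = Bot then 2 else (0::nat)"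
  have join: "join k x y \<notin> ?S" for k x y by simp
  have int: "interned ?S ?\<iota> 3 (\<lambda>_ _ _. 0)"
    by unfold_locales (auto simp: inj_on_def)
  have cmp: "watch_complete ?S (\<lambda>_. [])" using join by (simp add: watch_complete_def)
  show ?thesis
  proof (rule wpc_mark[of ?\<iota> ?S Top "[]"])
    show "inj_on ?\<iota> ?S" by (auto simp: inj_on_def)
    fix R :: regfile and A :: arrays
    assume *: "\<And>r. r \<noteq> 11 \<Longrightarrow> r \<noteq> 4 \<Longrightarrow> R r = ((\<lambda>_. 0)(0 := n)) r"
      "queued ?\<iota> (enqueue Top []) A (R 4)" "\<And>k. k \<noteq> 5 \<Longrightarrow> k \<noteq> 6 \<Longrightarrow> A k = (\<lambda>_ _. 0)"
    have "interned ?S ?\<iota> 3 A" by (rule interned_cong[OF int]) (auto intro: *(3))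
    moreover have "watched ?S ?\<iota> (\<lambda>_. []) A" by (simp add: watched_def *(3))
    ultimately have "store ?S ?\<iota> (\<lambda>_. []) [Top] (R 1 + 3) A (R 4)"
      using *(1)[of 1] *(2) cmp by (simp add: store_def enqueue_def)
    then have "reading (Atom [], [], []) R A"
      unfolding reading_def prod.case
      by (intro exI[of _ ?S] exI[of _ ?\<iota>] exI[of _ "\<lambda>_. []"] exI[of _ "[Top]"])
        (use *(1) in \<open>simp add: stacked_def\<close>)
    then show "reading (Atom [], [], []) R A \<and> R 1 = 0" using *(1)[of 1] by simp
  qed (use N in \<open>auto simp: queued_def\<close>)
qed

lemma tri_decision:
  assumes N: "4 * n + 16 \<le> N" and codes: "length codes = n"
    "\<And>i. i < n \<Longrightarrow> inp i = codes ! i" "\<And>i. i < n \<Longrightarrow> 0 < codes ! i"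
    and parse: "parse codes (Atom [], [], []) = Some (\<phi>, [], hs)"
  shows "tri decision_code ((\<lambda>_. 0)(0 := n)) (\<lambda>_ _ _. 0) (running_time n)
    (\<lambda>R A. R 8 = (if set hs \<turnstile> \<phi> then 1 else 0))"
  unfolding decision_code_def running_time_def
proof (rule tri_Seq[OF wpc_tri[OF reading_initial[OF N]]])
  fix R A assume init: "reading (Atom [], [], []) R A \<and> R 1 = 0"
  \<comment> \<open>Success of the parser is known only for the whole input. The invariant says that
    the remaining symbols lead to the known result, which forces each single step to
    succeed.\<close>
  define I where "I = (\<lambda>v R A. \<exists>p. reading p R A \<and> parse (drop (R 1) codes) p = Some (\<phi>, [], hs) \<and>
    v + R 1 = n)"
  let ?Q = "\<lambda>R A. R 8 = (if set hs \<turnstile> \<phi> then 1 else (0::nat))"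
  let ?t = "Lt (Reg 1) (Reg 0)"
  have "tri (While ?t read_code) R A (n * (cost read_code + 4) + 4)
      (\<lambda>R A. \<not> holds R ?t \<and> (\<exists>v. I v R A))"
  proof (rule tri_While)
    show "I n R A" unfolding I_def using init parse by (intro exI[of _ "(Atom [], [], [])"]) simp
    fix v R A assume "I v R A" and t: "holds R ?t"
    then obtain p where p: "reading p R A" "parse (drop (R 1) codes) p = Some (\<phi>, [], hs)" "v + R 1 = n"
      unfolding I_def by blast
    have "R 0 = n" using p(1) by (cases p) (auto simp: reading_def)
    then have lt: "R 1 < n" using t by simp
    then have "drop (R 1) codes = inp (R 1) # drop (R 1 + 1) codes"
      using codes by (simp add: Cons_nth_drop_Suc)
    then obtain p' where p': "parse_step (inp (R 1)) p = Some p'"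
      "parse (drop (R 1 + 1) codes) p' = Some (\<phi>, [], hs)"
      using p(2) by (auto simp del: parse_step.simps split: option.splits)
    have "0 < inp (R 1)" using codes lt by simp
    from read_step[OF p(1) lt N this p'(1)]
    show "wpc read_code R A (\<lambda>R' A'. \<exists>v'<v. I v' R' A')"
    proof (rule wpc_mono)
      fix R' A' assume *: "reading p' R' A' \<and> R' 1 = R 1 + 1"
      then have "I (v - 1) R' A'" unfolding I_def using p' p(3) lt by (intro exI[of _ p']) auto
      moreover have "v - 1 < v" using p(3) lt by simp
      ultimately show "\<exists>v'<v. I v' R' A'" by blast
    qed
  qed simp
  then show "tri (While ?t read_code ;; While (Lt (Reg 5) (Reg 4)) step_code ;; Get 8 5 (Reg 2) (Lit 0))
    R A (n * (cost read_code + 4) + 4 + (5 * (n + 3) * (cost step_code + 4) + 4 + 10)) ?Q"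
  proof (rule tri_Seq)
    fix R A assume *: "\<not> holds R ?t \<and> (\<exists>v. I v R A)"
    then obtain p where p: "reading p R A" "parse (drop (R 1) codes) p = Some (\<phi>, [], hs)" "\<not> R 1 < R 0"
      unfolding I_def by auto
    have "R 0 = n" using p(1) by (cases p) (auto simp: reading_def)
    then have "p = (\<phi>, [], hs)" using p codes by simp
    then obtain v where v: "v \<le> 5 * (n + 3)" "saturating (set hs) \<phi> v R A"
      using reading_saturating p(1) N by blast
    let ?t = "Lt (Reg 5) (Reg 4)"
    have "tri (While ?t step_code) R A (v * (cost step_code + 4) + 4)
        (\<lambda>R A. \<not> holds R ?t \<and> (\<exists>v. saturating (set hs) \<phi> v R A))"
      by (rule tri_While, rule v(2)) (use saturate_step in auto)
    moreover have "v * (cost step_code + 4) + 4 \<le> 5 * (n + 3) * (cost step_code + 4) + 4"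
      using v(1) by (intro add_mono mult_le_mono1) auto
    ultimately have "tri (While ?t step_code) R A (5 * (n + 3) * (cost step_code + 4) + 4)
        (\<lambda>R A. \<not> holds R ?t \<and> (\<exists>v. saturating (set hs) \<phi> v R A))"
      by (rule tri_mono)
    then show "tri (While ?t step_code ;; Get 8 5 (Reg 2) (Lit 0)) R A
      (5 * (n + 3) * (cost step_code + 4) + 4 + 10) ?Q"
    proof (rule tri_Seq)
      fix R A assume *: "\<not> holds R ?t \<and> (\<exists>v. saturating (set hs) \<phi> v R A)"
      then have "A 5 (R 2) 0 = (if set hs \<turnstile> \<phi> then 1 else 0)"
        using saturated[of "set hs" \<phi> _ R A] by auto
      then have "wpc (Get 8 5 (Reg 2) (Lit 0)) R A ?Q" by simp
      from wpc_tri[OF this] show "tri (Get 8 5 (Reg 2) (Lit 0)) R A 10 ?Q" by simp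
    qed
  qed
qed

end

section \<open>Runs of the whole program\<close>

lemma symbol_code_bounds: "0 < symbol_code s" "symbol_code s < 16"
  by (cases s; simp)+

lemma decides_instance:
  fixes w :: "symbol list"
  assumes parse: "parse (map symbol_code w) (Atom [], [], []) = Some (\<phi>, [], hs)"
    and B: "16 * (4 * length w + 16) * (4 * length w + 16) + (4 * length w + 16) \<le> B"
  shows "decides_within decision_program w (running_time (length w) + 6) B (set hs \<turnstile> \<phi>)"
proof -
  let ?n = "length w" and ?N = "4 * length w + 16" and ?P = decision_program
  let ?inp = "\<lambda>i. symbol_code (w ! i)"
  interpret ram ?N B ?n ?inp
  proof
    show "symbol_code (w ! i) < ?N" for i using symbol_code_bounds(2)[of "w ! i"] by linarith
  qed (use B in auto)
  let ?c0 = "init_config w"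
  let ?R0 = "(\<lambda>_. 0)(0 := ?n) :: regfile"
  let ?c1 = "fold exec set_up ?c0"
  have small: "v < B" if "v < ?N" for v using less_B that by simp
  have NB: "?N < B"
  proof -
    have "0 < 16 * ?N * ?N" by simp
    then show ?thesis using B by linarith
  qed
  have init: "words_below B ?c0"
  proof -
    have "symbol_code s < B" for s by (rule small) (use symbol_code_bounds(2)[of s] in linarith)
    then show ?thesis using NB by (auto simp: words_below_def init_config_def)
  qed
  have c1: "?c1 = ?c0\<lparr>pc := 5, regs := (regs ?c0)(1 := ?N, 2 := 16, 6 := ?n)\<rparr>"
    by (simp add: set_up_def init_config_def fun_eq_iff)
  have "stays_below B set_up ?c0"
    using NB init by (auto simp: set_up_def init_config_def words_below_def)
  moreover have "code_at ?P (pc ?c0) set_up"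
    by (auto simp: code_at_def decision_program_def init_config_def)
  moreover have "\<forall>i\<in>set set_up. \<not> is_jump i" by (simp add: set_up_def)
  ultimately have "reaches ?P B ?c0 (length set_up) ?c1"
    using reaches_straight[of ?P ?c0 set_up B] init by blast
  moreover have "length set_up = 5" by (simp add: set_up_def)
  ultimately have 1: "reaches ?P B ?c0 5 ?c1" by metis
  \<comment> \<open>Array addresses are at least \<open>?N\<close> and thus beyond the input, where
    all cells are blank; this is the representation of the zero arrays.\<close>
  have rep: "rep ?R0 (\<lambda>_ _ _. 0) ?c1"
    unfolding rep_def
  proof (intro conjI)
    show "words_below B ?c1" using 1 unfolding reaches_def by (metis order_refl)
    show "bounded ?R0 (\<lambda>_ _ _. 0)" by (simp add: bounded_def)
  qed (unfold c1, auto simp: init_config_def addr_def)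
  have "code_at ?P 5 (compile 5 decision_code)"
    unfolding code_at_def decision_program_def
    by (intro exI[of _ set_up] exI[of _ "[Move 0 14]"]) (simp add: set_up_def)
  moreover have pc1: "pc ?c1 = 5" unfolding c1 by simp
  ultimately have code: "code_at ?P (pc ?c1) (compile (pc ?c1) decision_code)"
    by (simp only: pc1)
  have tri: "tri decision_code ?R0 (\<lambda>_ _ _. 0) (running_time ?n)
      (\<lambda>R A. R 8 = (if set hs \<turnstile> \<phi> then 1 else 0))"
    by (rule tri_decision[OF _ _ _ _ parse]) (simp_all add: symbol_code_bounds)
  obtain t R A c2 where 2: "t \<le> running_time ?n" "reaches ?P B ?c1 t c2"
    "R 8 = (if set hs \<turnstile> \<phi> then 1 else (0::nat))" "rep R A c2" "pc c2 = pc ?c1 + code_length decision_code"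
    using triD[OF tri code rep] .
  let ?c3 = "exec (?P ! pc c2) c2"
  have last: "?P ! pc c2 = Move 0 14" "Suc (pc c2) = length ?P"
    using 2(5) unfolding pc1 by (simp_all add: decision_program_def set_up_def nth_append)
  have c3: "?c3 = c2\<lparr>pc := pc c2 + 1, regs := (regs c2)(0 := R 8)\<rparr>"
  proof -
    have "regs c2 (8 + 6) = R 8" using 2(4) unfolding rep_def by blast
    then show ?thesis by (simp add: last)
  qed
  have "R 8 < B" by (rule small) (simp add: 2(3))
  then have "words_below B ?c3"
    unfolding c3 using words_below_reg rep_words_below[OF 2(4)] by blast
  moreover have "pc c2 < length ?P" using last(2) by linarith
  ultimately have 3: "reaches ?P B c2 1 ?c3"
    using reaches_step rep_words_below[OF 2(4)] by blast
  have all: "reaches ?P B ?c0 (5 + t + 1) ?c3"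
    using reaches_trans[OF reaches_trans[OF 1 2(2)] 3] .
  show ?thesis
    unfolding decides_within_def
  proof (intro exI[of _ "5 + t + 1"] conjI)
    have run: "run ?P (5 + t + 1) ?c0 = ?c3" using all by (simp add: reaches_def)
    show "halted ?P (run ?P (5 + t + 1) ?c0)" unfolding run halted_def c3 using last by simp
    show "regs (run ?P (5 + t + 1) ?c0) 0 = (if set hs \<turnstile> \<phi> then 1 else 0)"
      unfolding run c3 using 2(3) by simp
    show "\<forall>s\<le>5 + t + 1. words_below B (run ?P s ?c0)" using all by (simp add: reaches_def)
    show "5 + t + 1 \<le> running_time ?n + 6" using 2(1) by simp
  qed
qed

section \<open>Lengths of written instances and final bounds\<close>

lemma write_infon_map:
  "write_infon name \<phi> = write_infon (\<lambda>bs. bs) (map_infon name \<phi>)"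
  by (induction \<phi>) auto

lemma write_instance_map:
  "write_instance name (\<gamma>s, \<phi>) =
     write_instance (\<lambda>bs. bs) (map (map_infon name) \<gamma>s, map_infon name \<phi>)"
  by (simp add: write_instance_def write_infon_map[of name] comp_def)

lemma infon_length_pos: "(\<And>a. name a \<noteq> []) \<Longrightarrow> 1 \<le> infon_length name \<phi>"
  by (cases \<phi>) (auto simp: infon_length_def Suc_le_eq)

text \<open>Separators are not counted in the total length. Nonempty names make every infon at least
  one symbol long, so a comma at most doubles a hypothesis, and the turnstile is paid for by the
  query.\<close>

lemma length_write_instance:
  assumes "\<And>a. name a \<noteq> []"
  shows "length (write_instance name x) \<le> 3 * total_length name x" "1 \<le> total_length name x"
proof -
  obtain \<gamma>s \<phi> where x: "x = (\<gamma>s, \<phi>)" by (cases x)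
  have "length (concat (map (\<lambda>\<gamma>. write_infon name \<gamma> @ [Comma]) \<gamma>s)) \<le>
      2 * (\<Sum>\<gamma>\<leftarrow>\<gamma>s. infon_length name \<gamma>)"
  proof (induction \<gamma>s)
    case (Cons \<gamma> \<gamma>s)
    then show ?case using infon_length_pos[of name \<gamma>, OF assms] by (simp add: infon_length_def)
  qed simp
  then show "length (write_instance name x) \<le> 3 * total_length name x" "1 \<le> total_length name x"
    using infon_length_pos[of name \<phi>, OF assms]
    by (simp_all add: x write_instance_def total_length_def infon_length_def)
qed

lemma running_time_linear: "\<exists>c. \<forall>l n. 1 \<le> l \<longrightarrow> n \<le> 3 * l \<longrightarrow> running_time n + 6 \<le> c * l"
proof -
  define a b d where "a = cost (mark_code (Lit 1))" and "b = cost read_code + 4"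
    and "d = cost step_code + 4"
  \<comment> \<open>30 comes from \<open>5 * (n + 3) \<le> 30 * l\<close>, and 24 collects the
    constants 4, 4, 10 and 6; the last is the set-up and the final move.\<close>
  have "running_time n + 6 \<le> (a + 3 * b + 30 * d + 24) * l" if l: "1 \<le> l" "n \<le> 3 * l" for l n
  proof -
    have "a \<le> a * l" "24 \<le> 24 * l" using l by simp_all
    moreover have "n * b \<le> 3 * l * b" using l by (intro mult_le_mono1)
    moreover have "5 * (n + 3) * d \<le> 30 * l * d" using l by (intro mult_le_mono1) simp
    ultimately have "a + (n * b + 4 + (5 * (n + 3) * d + 4 + 10)) + 6 \<le>
      a * l + 3 * l * b + 30 * l * d + 24 * l" by linarith
    then show ?thesis by (simp add: running_time_def a_def b_def d_def algebra_simps)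
  qed
  then show ?thesis by blast
qed

lemma address_space_bound:
  assumes "n \<le> 3 * l" "1 \<le> (l::nat)"
  shows "16 * (4 * n + 16) * (4 * n + 16) + (4 * n + 16) \<le> (l + 2) ^ 10"
proof -
  \<comment> \<open>The square of \<open>N\<close> accounts for two powers of \<open>L\<close>. The
    remaining factor 2316 = 16 * 144 + 12 is absorbed by eight more powers because \<open>L\<close>
    is at least 3; the seventh power of 3 is only 2187.\<close>
  define L N where "L = l + 2" and "N = 4 * n + 16"
  have N: "N \<le> 12 * L" and L: "3 \<le> L" using assms by (simp_all add: L_def N_def)
  have "N * N \<le> (12 * L) * (12 * L)" using N by (intro mult_le_mono)
  then have "16 * N * N \<le> 2304 * (L * L)" by simp
  moreover have "12 * L \<le> 12 * (L * L)" by simp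
  ultimately have "16 * N * N + N \<le> 2316 * (L * L)" using N by linarith
  also have "\<dots> \<le> 3 ^ 8 * (L * L)" by simp
  also have "\<dots> \<le> L ^ 8 * (L * L)" using L by (intro mult_le_mono1 power_mono) auto
  also have "\<dots> = L ^ 10" by (simp add: eval_nat_numeral)
  finally show ?thesis by (simp only: L_def N_def)
qed

theorem theorem5:
  fixes name :: "'a \<Rightarrow> bool list"
  assumes "inj name" and "\<And>a. name a \<noteq> []"
  shows "linear_time_decidable (write_instance name) (total_length name)
           (\<lambda>(\<gamma>s, \<phi>). set \<gamma>s \<turnstile> \<phi>)"
proof -
  obtain c where c: "\<And>l n. 1 \<le> l \<Longrightarrow> n \<le> 3 * l \<Longrightarrow> running_time n + 6 \<le> c * l"
    using running_time_linear by blast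
  have "decides_within decision_program (write_instance name x) (c * total_length name x)
      ((total_length name x + 2) ^ 10) (case x of (\<gamma>s, \<phi>) \<Rightarrow> set \<gamma>s \<turnstile> \<phi>)" for x
  proof -
    obtain \<gamma>s \<phi> where x: "x = (\<gamma>s, \<phi>)" by (cases x)
    let ?w = "write_instance name x"
    let ?f = "map_infon name"
    have len: "length ?w \<le> 3 * total_length name x" "1 \<le> total_length name x"
      using length_write_instance[of name x, OF assms(2)] .
    \<comment> \<open>The written form is that of the instance with each atom replaced by its name,
      so the machine decides the renamed problem; injectivity of \<open>name\<close> transfers the
      answer.\<close>
    have "parse (map symbol_code ?w) (Atom [], [], []) = Some (?f \<phi>, [], rev (map ?f \<gamma>s))"
      unfolding x write_instance_map[of name] by (rule parse_instance)
    from decides_instance[OF this address_space_bound[OF len]]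
    have "decides_within decision_program ?w (running_time (length ?w) + 6)
      ((total_length name x + 2) ^ 10) (?f ` set \<gamma>s \<turnstile> ?f \<phi>)" by simp
    then show ?thesis
      using c[OF len(2,1)] unfolding decides_within_def derives_map_iff[OF assms(1)] x
      by (auto intro: order_trans)
  qed
  then show ?thesis unfolding linear_time_decidable_def by blast
qed

end
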